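(* Let $\mathcal A$ be a unital $C^*$-algebra, and let $\mathcal C(\mathcal A)$ be the diagram of all unital commutative $C^*$-subalgebras of $\mathcal A$ (with the inclusion relation). Then: (1) for every $\mathcal A_\alpha\in\mathcal C(\mathcal A)$, its self-adjoint part $\mathcal A_\alpha^{sa}$ is a Banach unital associative subalgebra of the JB-algebra $\mathcal A^{sa}$; (2) $\mathcal A^{sa}$ is covered by $\{\mathcal A_\alpha^{sa}:\mathcal A_\alpha\in\mathcal C(\mathcal A)\}$; (3) $S(\mathcal A)$ is determined by $\mathcal A^{sa}$; (4) $\mathcal C(\mathcal A)$ is determined by $\mathcal A^{sa}$.
   Context: $\mathcal A^{sa}$ is the ordered real Banach space of self-adjoint elements of $\mathcal A$, with the norm and order inherited from $\mathcal A$; it is a JB-algebra (Jordan Banach algebra) for the Jordan product $a\circ b:=\frac12(ab+ba)$. A unital $C^*$-subalgebra of $\mathcal A$ is a subset that contains the unit of $\mathcal A$ and is a unital $C^*$-algebra for the inherited multiplication, involution and linear structure. $\mathcal C(\mathcal A)=(\{\mathcal A_\alpha\},\subseteq)$ is regarded as a diagram in the category whose objects are unital commutative $C^*$-algebras and whose morphisms are injective unital $C^*$-homomorphisms, the morphisms of the diagram being the inclusions. $S(\mathcal A)$ is the state space of $\mathcal A$, i.e. the positive part of the unit sphere of the Banach dual $\mathcal A^*$, with the weak$^*$-topology. *)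

theory Defs
  imports "HOL-Analysis.Analysis"
begin

section \<open>Unital C*-algebras\<close>

class cstar_algebra = real_normed_algebra_1 + banach +
  fixes scaleC :: "complex \<Rightarrow> 'a \<Rightarrow> 'a"  (infixr \<open>*\<^sub>C\<close> 75)
    and adj :: "'a \<Rightarrow> 'a"
  assumes scaleC_add_right: "c *\<^sub>C (x + y) = c *\<^sub>C x + c *\<^sub>C y"
    and scaleC_add_left: "(c + d) *\<^sub>C x = c *\<^sub>C x + d *\<^sub>C x"
    and scaleC_scaleC: "c *\<^sub>C (d *\<^sub>C x) = (c * d) *\<^sub>C x"
    and scaleR_eq_scaleC: "r *\<^sub>R x = complex_of_real r *\<^sub>C x"
    and mult_scaleC_left: "(c *\<^sub>C x) * y = c *\<^sub>C (x * y)"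
    and mult_scaleC_right: "x * (c *\<^sub>C y) = c *\<^sub>C (x * y)"
    and norm_scaleC: "norm (c *\<^sub>C x) = cmod c * norm x"
    and adj_adj: "adj (adj x) = x"
    and adj_add: "adj (x + y) = adj x + adj y"
    and adj_scaleC: "adj (c *\<^sub>C x) = cnj c *\<^sub>C adj x"
    and adj_mult: "adj (x * y) = adj y * adj x"
    and cstar_identity: "norm (adj x * x) = (norm x)\<^sup>2"

instantiation complex :: cstar_algebra
begin

definition scaleC_complex :: "complex \<Rightarrow> complex \<Rightarrow> complex"
  where "scaleC_complex c x = c * x"

definition adj_complex :: "complex \<Rightarrow> complex"
  where "adj_complex = cnj"

instance
  by standard
    (auto simp: scaleC_complex_def adj_complex_def algebra_simps scaleR_conv_of_real
      norm_mult power2_eq_square)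

end

text \<open>Completeness is with respect to the inherited norm, which is the only norm making a
  *-subalgebra a C*-algebra.\<close>

definition unital_cstar_subalgebra :: "'a::cstar_algebra set \<Rightarrow> bool" where
  "unital_cstar_subalgebra C \<longleftrightarrow>
     1 \<in> C \<and>
     (\<forall>x\<in>C. \<forall>y\<in>C. x + y \<in> C) \<and>
     (\<forall>c. \<forall>x\<in>C. c *\<^sub>C x \<in> C) \<and>
     (\<forall>x\<in>C. \<forall>y\<in>C. x * y \<in> C) \<and>
     (\<forall>x\<in>C. adj x \<in> C) \<and>
     complete C"

definition comm_subalgebras :: "'a::cstar_algebra set set" where
  "comm_subalgebras = {C. unital_cstar_subalgebra C \<and> (\<forall>x\<in>C. \<forall>y\<in>C. x * y = y * x)}"

definition unital_star_isomorphism ::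
    "'a::cstar_algebra set \<Rightarrow> 'b::cstar_algebra set \<Rightarrow> ('a \<Rightarrow> 'b) \<Rightarrow> bool" where
  "unital_star_isomorphism C D h \<longleftrightarrow>
     bij_betw h C D \<and>
     h 1 = 1 \<and>
     (\<forall>x\<in>C. \<forall>y\<in>C. h (x + y) = h x + h y) \<and>
     (\<forall>c. \<forall>x\<in>C. h (c *\<^sub>C x) = c *\<^sub>C h x) \<and>
     (\<forall>x\<in>C. \<forall>y\<in>C. h (x * y) = h x * h y) \<and>
     (\<forall>x\<in>C. h (adj x) = adj (h x))"

text \<open>An isomorphism of the diagrams of commutative subalgebras of two C*-algebras: an isomorphism
  \<open>F\<close> of the index posets together with isomorphisms \<open>\<eta> C\<close> from \<open>C\<close> onto \<open>F C\<close> that are natural,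
  i.e. commute with all the inclusions.\<close>

definition diagram_isomorphism ::
    "('a::cstar_algebra set \<Rightarrow> 'b::cstar_algebra set) \<Rightarrow> ('a set \<Rightarrow> 'a \<Rightarrow> 'b) \<Rightarrow> bool" where
  "diagram_isomorphism F \<eta> \<longleftrightarrow>
     bij_betw F comm_subalgebras comm_subalgebras \<and>
     (\<forall>C\<in>comm_subalgebras. \<forall>D\<in>comm_subalgebras. C \<subseteq> D \<longleftrightarrow> F C \<subseteq> F D) \<and>
     (\<forall>C\<in>comm_subalgebras. unital_star_isomorphism C (F C) (\<eta> C)) \<and>
     (\<forall>C\<in>comm_subalgebras. \<forall>D\<in>comm_subalgebras. C \<subseteq> D \<longrightarrow> (\<forall>x\<in>C. \<eta> D x = \<eta> C x))"


section \<open>JB-algebras and the self-adjoint part\<close>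

definition sa_part :: "'a::cstar_algebra set \<Rightarrow> 'a set" where
  "sa_part C = {a \<in> C. adj a = a}"

abbreviation sa :: "'a::cstar_algebra set" where
  "sa \<equiv> sa_part UNIV"

definition jordan :: "'a::cstar_algebra \<Rightarrow> 'a \<Rightarrow> 'a"  (infixl \<open>\<circ>\<^sub>J\<close> 70) where
  "a \<circ>\<^sub>J b = (1 / 2) *\<^sub>R (a * b + b * a)"

definition cstar_le :: "'a::cstar_algebra \<Rightarrow> 'a \<Rightarrow> bool" where
  "cstar_le a b \<longleftrightarrow> (\<exists>x. b - a = adj x * x)"

text \<open>\<open>V\<close> with the product \<open>p\<close> and the norm of the ambient space is a unital JB-algebra with
  unit \<open>u\<close>; \<open>p\<close> is only relevant on \<open>V\<close>. Right linearity of \<open>p\<close> follows from commutativity.\<close>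

definition unital_jb_algebra ::
    "'v::real_normed_vector set \<Rightarrow> ('v \<Rightarrow> 'v \<Rightarrow> 'v) \<Rightarrow> 'v \<Rightarrow> bool" where
  "unital_jb_algebra V p u \<longleftrightarrow>
     subspace V \<and> complete V \<and>
     (\<forall>a\<in>V. \<forall>b\<in>V. p a b \<in> V) \<and>
     (\<forall>a\<in>V. \<forall>b\<in>V. \<forall>c\<in>V. p (a + b) c = p a c + p b c) \<and>
     (\<forall>r. \<forall>a\<in>V. \<forall>b\<in>V. p (r *\<^sub>R a) b = r *\<^sub>R p a b) \<and>
     (\<forall>a\<in>V. \<forall>b\<in>V. p a b = p b a) \<and>
     (\<forall>a\<in>V. \<forall>b\<in>V. p (p a b) (p a a) = p a (p b (p a a))) \<and>
     u \<in> V \<and> (\<forall>a\<in>V. p u a = a) \<and>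
     (\<forall>a\<in>V. \<forall>b\<in>V. norm (p a b) \<le> norm a * norm b) \<and>
     (\<forall>a\<in>V. norm (p a a) = (norm a)\<^sup>2) \<and>
     (\<forall>a\<in>V. \<forall>b\<in>V. norm (p a a) \<le> norm (p a a + p b b))"

definition banach_unital_assoc_subalgebra ::
    "'v::real_normed_vector set \<Rightarrow> ('v \<Rightarrow> 'v \<Rightarrow> 'v) \<Rightarrow> 'v \<Rightarrow> 'v set \<Rightarrow> bool" where
  "banach_unital_assoc_subalgebra V p u W \<longleftrightarrow>
     W \<subseteq> V \<and> subspace W \<and> complete W \<and> u \<in> W \<and>
     (\<forall>a\<in>W. \<forall>b\<in>W. p a b \<in> W) \<and>
     (\<forall>a\<in>W. \<forall>b\<in>W. \<forall>c\<in>W. p (p a b) c = p a (p b c))"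

definition linear_isomorphism ::
    "'v::real_vector set \<Rightarrow> 'w::real_vector set \<Rightarrow> ('v \<Rightarrow> 'w) \<Rightarrow> bool" where
  "linear_isomorphism V W h \<longleftrightarrow>
     bij_betw h V W \<and>
     (\<forall>a\<in>V. \<forall>b\<in>V. h (a + b) = h a + h b) \<and>
     (\<forall>r. \<forall>a\<in>V. h (r *\<^sub>R a) = r *\<^sub>R h a)"

text \<open>Isomorphisms of self-adjoint parts, as JB-algebras and as ordered Banach spaces.\<close>

definition sa_jordan_isomorphism :: "('a::cstar_algebra \<Rightarrow> 'b::cstar_algebra) \<Rightarrow> bool" where
  "sa_jordan_isomorphism h \<longleftrightarrow>
     linear_isomorphism sa sa h \<and>
     (\<forall>a\<in>sa. \<forall>b\<in>sa. h (a \<circ>\<^sub>J b) = h a \<circ>\<^sub>J h b)"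

definition sa_order_isomorphism :: "('a::cstar_algebra \<Rightarrow> 'b::cstar_algebra) \<Rightarrow> bool" where
  "sa_order_isomorphism h \<longleftrightarrow>
     linear_isomorphism sa sa h \<and>
     (\<forall>a\<in>sa. norm (h a) = norm a) \<and>
     (\<forall>a\<in>sa. \<forall>b\<in>sa. cstar_le a b \<longleftrightarrow> cstar_le (h a) (h b))"


section \<open>State spaces\<close>

definition states :: "('a::cstar_algebra \<Rightarrow> complex) set" where
  "states = {f. bounded_linear f \<and> (\<forall>c x. f (c *\<^sub>C x) = c * f x) \<and>
     (\<forall>x. cstar_le 0 x \<longrightarrow> f x \<in> \<real>\<^sub>\<ge>\<^sub>0) \<and> onorm f = 1}"

text \<open>The positive part of the unit sphere of the Banach dual of the ordered real Banach space of
  self-adjoint elements. Functionals on \<open>sa\<close> are represented by functions that are \<open>undefined\<close>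
  outside \<open>sa\<close>; the supremum is their dual norm, as in the definition of \<open>onorm\<close>.\<close>

definition sa_states :: "('a::cstar_algebra \<Rightarrow> real) set" where
  "sa_states = {f \<in> extensional sa.
     (\<forall>a\<in>sa. \<forall>b\<in>sa. f (a + b) = f a + f b) \<and>
     (\<forall>r. \<forall>a\<in>sa. f (r *\<^sub>R a) = r * f a) \<and>
     (\<exists>K. \<forall>a\<in>sa. \<bar>f a\<bar> \<le> K * norm a) \<and>
     (\<forall>a\<in>sa. cstar_le 0 a \<longrightarrow> 0 \<le> f a) \<and>
     (SUP a\<in>sa. \<bar>f a\<bar> / norm a) = 1}"

text \<open>The weak* topology on a set \<open>S\<close> of functionals on \<open>X\<close>, i.e. the topology of pointwise
  convergence on \<open>X\<close>.\<close>

definition weak_star :: "'v set \<Rightarrow> ('v \<Rightarrow> 's::topological_space) set \<Rightarrow> ('v \<Rightarrow> 's) topology" where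
  "weak_star X S = subtopology (product_topology (\<lambda>_. euclidean) X) S"

definition affine_homeomorphism ::
    "'v set \<Rightarrow> ('v \<Rightarrow> 's::real_normed_vector) set \<Rightarrow>
     'w set \<Rightarrow> ('w \<Rightarrow> 't::real_normed_vector) set \<Rightarrow>
     (('v \<Rightarrow> 's) \<Rightarrow> ('w \<Rightarrow> 't)) \<Rightarrow> bool" where
  "affine_homeomorphism X S Y T h \<longleftrightarrow>
     homeomorphic_map (weak_star X S) (weak_star Y T) h \<and>
     (\<forall>f\<in>S. \<forall>g\<in>S. \<forall>k\<in>S. \<forall>t\<in>{0..1}.
        (\<forall>x\<in>X. k x = (1 - t) *\<^sub>R f x + t *\<^sub>R g x) \<longrightarrow>
        (\<forall>y\<in>Y. h k y = (1 - t) *\<^sub>R h f y + t *\<^sub>R h g y))"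

definition restrict_to_sa :: "('a::cstar_algebra \<Rightarrow> complex) \<Rightarrow> 'a \<Rightarrow> real" where
  "restrict_to_sa f = (\<lambda>a\<in>sa. Re (f a))"

end

(* Everything rests on square roots of M - a for self-adjoint a with norm a < M. They give
   norm c <= R as soon as R - c and R + c are positive, hence the JB norm axiom, the isometry of
   Jordan isomorphisms, and norm f = f 1 for positive functionals; no spectral theory is needed.
   An associative Jordan algebra of self-adjoint elements is commutative for the associative
   product, so C |-> sa_part C and J |-> J + i J are mutually inverse, and maps and functionals
   on the self-adjoint part are transported by complex linear extension. *)

theory Submission
  imports Defs
begin

section \<open>Self-adjoint elements\<close>

text \<open>Two notions of positivity are kept apart. The statement speaks of
  \<open>cstar_le\<close>, that is of elements \<open>adj x * x\<close>; the norm estimates use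
  \<open>psd\<close>. They meet in the squares of self-adjoint elements, which are positive in both
  senses, and positive functionals are tested on such squares. A Jordan isomorphism knows products
  only up to their order: transposition of matrices preserves \<open>\<circ>\<^sub>J\<close> and
  reverses products. So its complex linear extension cannot be expected to be multiplicative on the
  whole algebra. It is so on commuting elements, and these are all that the diagram of commutative
  subalgebras sees.\<close>

lemma scaleC_zero_right [simp]: "c *\<^sub>C (0::'a::cstar_algebra) = 0"
  using scaleC_add_right[of c 0 "0::'a"] by simp

lemma scaleC_zero_left [simp]: "0 *\<^sub>C (x::'a::cstar_algebra) = 0"
  using scaleC_add_left[of 0 0 x] by simp

lemma scaleC_one [simp]: "1 *\<^sub>C (x::'a::cstar_algebra) = x"
  using scaleR_eq_scaleC[of 1 x] by simp

lemma scaleC_minus_right: "c *\<^sub>C (- x::'a::cstar_algebra) = - (c *\<^sub>C x)"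
  by (metis add.right_inverse minus_unique scaleC_add_right scaleC_zero_right)

lemma scaleC_minus_left: "(- c) *\<^sub>C (x::'a::cstar_algebra) = - (c *\<^sub>C x)"
  by (metis add.right_inverse minus_unique scaleC_add_left scaleC_zero_left)

lemma scaleC_diff_right: "c *\<^sub>C (x - y::'a::cstar_algebra) = c *\<^sub>C x - c *\<^sub>C y"
  using scaleC_add_right[of c x "- y"] by (simp add: scaleC_minus_right)

lemma scaleC_scaleR_commute: "c *\<^sub>C r *\<^sub>R x = r *\<^sub>R c *\<^sub>C (x::'a::cstar_algebra)"
  by (simp add: scaleR_eq_scaleC scaleC_scaleC mult.commute)

lemma scaleC_ii: "\<i> *\<^sub>C \<i> *\<^sub>C (x::'a::cstar_algebra) = - x"
  by (simp add: scaleC_scaleC scaleC_minus_left)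

lemma scaleC_Re_Im: "c *\<^sub>C (x::'a::cstar_algebra) = Re c *\<^sub>R x + Im c *\<^sub>R \<i> *\<^sub>C x"
proof -
  have "c *\<^sub>C x = (complex_of_real (Re c) + complex_of_real (Im c) * \<i>) *\<^sub>C x"
    by (metis complex_eq mult.commute)
  then show ?thesis
    by (simp only: scaleC_add_left scaleR_eq_scaleC scaleC_scaleC)
qed

lemma adj_scaleR: "adj (r *\<^sub>R x) = r *\<^sub>R adj (x::'a::cstar_algebra)"
  by (simp add: scaleR_eq_scaleC adj_scaleC)

lemma adj_zero [simp]: "adj (0::'a::cstar_algebra) = 0"
  using adj_add[of 0 "0::'a"] by simp

lemma adj_minus: "adj (- x) = - adj (x::'a::cstar_algebra)"
  by (metis add.right_inverse adj_add adj_zero minus_unique)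

lemma adj_diff: "adj (x - y) = adj x - adj (y::'a::cstar_algebra)"
  using adj_add[of x "- y"] by (simp add: adj_minus)

lemma adj_one [simp]: "adj (1::'a::cstar_algebra) = 1"
  by (metis adj_adj adj_mult mult.right_neutral)

text \<open>The C*-identity and submultiplicativity bound \<open>(norm y)\<^sup>2\<close> by
  \<open>norm (adj y) * norm y\<close>; cancel \<open>norm y\<close>, then use this for both
  \<open>x\<close> and \<open>adj x\<close>.\<close>

lemma norm_adj [simp]: "norm (adj x) = norm (x::'a::cstar_algebra)"
proof -
  have le: "norm y \<le> norm (adj y)" for y :: 'a
  proof (cases "y = 0")
    case False
    have "(norm y)\<^sup>2 \<le> norm (adj y) * norm y"
      by (metis cstar_identity norm_mult_ineq)
    with False show ?thesis by (simp add: power2_eq_square)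
  qed simp
  show ?thesis using le[of x] le[of "adj x"] by (simp add: adj_adj)
qed

lemma bounded_linear_adj: "bounded_linear (adj :: 'a::cstar_algebra \<Rightarrow> 'a)"
  by (rule bounded_linear_intro[where K = 1]) (auto simp: adj_add adj_scaleR)

lemma continuous_on_adj [continuous_intros]:
  "continuous_on S f \<Longrightarrow> continuous_on S (\<lambda>x. adj (f x :: 'a::cstar_algebra))"
  by (rule bounded_linear.continuous_on[OF bounded_linear_adj])

lemma mem_sa [simp]: "a \<in> sa \<longleftrightarrow> adj a = a"
  by (simp add: sa_part_def)

section \<open>Real and imaginary parts\<close>

definition rpart :: "'a::cstar_algebra \<Rightarrow> 'a" where
  "rpart x = (1/2) *\<^sub>R (x + adj x)"

text \<open>The usual \<open>(x - adj x) / (2 \<i>)\<close>, its scalar split into a real factor and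
  \<open>\<i>\<close>, in keeping with the separate rules for real scalars and for
  \<open>\<i>\<close>.\<close>

definition ipart :: "'a::cstar_algebra \<Rightarrow> 'a" where
  "ipart x = - (1/2) *\<^sub>R \<i> *\<^sub>C (x - adj x)"

lemma adj_rpart [simp]: "adj (rpart x) = rpart x"
  by (simp add: rpart_def adj_scaleR adj_add adj_adj add.commute)

lemma adj_ipart [simp]: "adj (ipart x) = ipart x"
proof -
  have "adj (\<i> *\<^sub>C (x - adj x)) = \<i> *\<^sub>C (x - adj x)"
    by (simp add: adj_scaleC adj_diff adj_adj scaleC_minus_left scaleC_diff_right)
  then show ?thesis by (simp only: ipart_def adj_scaleR)
qed

lemma rpart_ipart: "rpart x + \<i> *\<^sub>C ipart x = (x::'a::cstar_algebra)"
proof -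
  have "\<i> *\<^sub>C ipart x = - (1/2) *\<^sub>R - (x - adj x)"
    by (simp only: ipart_def scaleC_scaleR_commute scaleC_ii)
  then have "\<i> *\<^sub>C ipart x = (1/2) *\<^sub>R (x - adj x)" by (simp only: scaleR_minus_left scaleR_minus_right minus_minus)
  then have "rpart x + \<i> *\<^sub>C ipart x = (1/2) *\<^sub>R ((x + adj x) + (x - adj x))"
    by (simp only: rpart_def scaleR_add_right)
  then show ?thesis by (simp flip: scaleR_2)
qed

lemma rpart_add: "rpart (x + y) = rpart x + rpart y"
  by (simp add: rpart_def adj_add algebra_simps)

lemma ipart_add: "ipart (x + y) = ipart x + ipart y"
  by (simp add: ipart_def adj_add scaleC_add_right scaleC_diff_right algebra_simps)

lemma rpart_scaleR: "rpart (r *\<^sub>R x) = r *\<^sub>R rpart x"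
  by (simp add: rpart_def adj_scaleR algebra_simps)

lemma ipart_scaleR: "ipart (r *\<^sub>R x) = r *\<^sub>R ipart x"
  by (simp add: ipart_def adj_scaleR scaleC_diff_right scaleC_scaleR_commute algebra_simps)

lemma rpart_ii: "rpart (\<i> *\<^sub>C x) = - ipart x"
  by (simp add: rpart_def ipart_def adj_scaleC scaleC_minus_left scaleC_diff_right)

lemma ipart_ii: "ipart (\<i> *\<^sub>C x) = rpart x"
  by (simp add: rpart_def ipart_def adj_scaleC scaleC_minus_left scaleC_diff_right scaleC_minus_right
      scaleC_ii algebra_simps scaleC_add_right)

lemma rpart_sa [simp]: "adj a = a \<Longrightarrow> rpart a = a"
  by (simp add: rpart_def flip: scaleR_2)

lemma ipart_sa [simp]: "adj a = a \<Longrightarrow> ipart a = 0"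
  by (simp add: ipart_def)

lemma rpart_sum_sa: "adj a = a \<Longrightarrow> adj b = b \<Longrightarrow> rpart (a + \<i> *\<^sub>C b) = a"
  by (simp add: rpart_add rpart_ii)

lemma ipart_sum_sa: "adj a = a \<Longrightarrow> adj b = b \<Longrightarrow> ipart (a + \<i> *\<^sub>C b) = b"
  by (simp add: ipart_add ipart_ii)

lemma rpart_adj: "rpart (adj x) = rpart x"
  by (simp add: rpart_def adj_adj add.commute)

lemma ipart_adj: "ipart (adj x) = - ipart x"
  by (simp add: ipart_def adj_adj scaleC_diff_right algebra_simps)

lemma norm_rpart: "norm (rpart x) \<le> norm x"
  using norm_triangle_ineq[of x "adj x"] by (simp add: rpart_def)

lemma norm_ipart: "norm (ipart x) \<le> norm x"
  using norm_triangle_ineq4[of x "adj x"] by (simp add: ipart_def norm_scaleC)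

lemma continuous_rpart: "continuous_on S (rpart :: 'a::cstar_algebra \<Rightarrow> 'a)"
  by (rule linear_continuous_on, rule bounded_linear_intro[where K = 1])
    (auto simp: rpart_add rpart_scaleR norm_rpart)

lemma continuous_ipart: "continuous_on S (ipart :: 'a::cstar_algebra \<Rightarrow> 'a)"
  by (rule linear_continuous_on, rule bounded_linear_intro[where K = 1])
    (auto simp: ipart_add ipart_scaleR norm_ipart)

lemma norm_square_sa: "adj a = a \<Longrightarrow> norm (a * a) = (norm (a::'a::cstar_algebra))\<^sup>2"
  by (metis cstar_identity)


section \<open>Square roots and positivity\<close>

text \<open>If \<open>y = (b + y\<^sup>2) / 2\<close>, then \<open>(1 - y)\<^sup>2 = 1 - b\<close>. Working inside the bicommutant of \<open>b\<close> makes
  the right-hand side a contraction of a ball of radius \<open>1 - sqrt (1 - norm b)\<close>.\<close>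

lemma sqrt_one_minus:
  fixes b :: "'a::cstar_algebra"
  assumes b: "adj b = b" "norm b < 1"
  obtains s where "adj s = s" "s * s = 1 - b" "\<And>z. z * b = b * z \<Longrightarrow> z * s = s * z"
proof -
  \<comment> \<open>The smaller root of the scalar equation \<open>2 * r = norm b + r * r\<close>:
    thus \<open>f\<close> maps the ball of radius \<open>r\<close> into itself, and
    \<open>r < 1\<close> is its contraction factor.\<close>
  define r where "r = 1 - sqrt (1 - norm b)"
  have r: "0 \<le> r" "r < 1" using b by (auto simp: r_def)
  have "(1 - r)\<^sup>2 = 1 - norm b" using b by (simp add: r_def)
  then have rr: "norm b + r * r = 2 * r" by (simp add: power2_eq_square algebra_simps)
  define f where "f y = (1/2) *\<^sub>R (b + y * y)" for y
  define S where "S = {y. norm y \<le> r \<and> adj y = y \<and> (\<forall>z. z * b = b * z \<longrightarrow> z * y = y * z)}"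
  have "closed S" unfolding S_def
    by (intro closed_Collect_conj closed_Collect_all closed_Collect_imp open_Collect_const
        closed_Collect_le closed_Collect_eq continuous_intros)
  then have "complete S" by (simp add: complete_eq_closed)
  have S_iff: "y \<in> S \<longleftrightarrow> norm y \<le> r \<and> adj y = y \<and> (\<forall>z. z * b = b * z \<longrightarrow> z * y = y * z)" for y
    by (simp only: S_def mem_Collect_eq)
  \<comment> \<open>Testing \<open>z \<in> S\<close> with \<open>b\<close> shows that
    \<open>z\<close> commutes with \<open>b\<close>; then \<open>z\<close> itself is a legitimate
    test element for \<open>y \<in> S\<close>.\<close>
  have comm: "y * z = z * y" if "y \<in> S" "z \<in> S" for y z
    using that unfolding S_iff by metis
  have "0 \<in> S" using r unfolding S_iff by simp
  have "f y \<in> S" if y: "y \<in> S" for y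
  proof -
    have "norm y \<le> r" "adj y = y" using y S_iff by blast+
    have "norm (b + y * y) \<le> norm b + norm y * norm y"
      using norm_triangle_ineq norm_mult_ineq by (metis add_left_mono order_trans)
    also have "\<dots> \<le> norm b + r * r"
      using \<open>norm y \<le> r\<close> by (intro add_left_mono mult_mono) (auto simp: r)
    finally have "norm (f y) \<le> r" using rr by (simp add: f_def)
    moreover have "adj (f y) = f y"
      using \<open>adj y = y\<close> b by (simp add: f_def adj_scaleR adj_add adj_mult)
    moreover have "z * f y = f y * z" if z: "z * b = b * z" for z
    proof -
      have zy: "z * y = y * z" using y z S_iff by blast
      then have "z * (y * y) = y * y * z" by (metis mult.assoc)
      with z show ?thesis by (simp add: f_def distrib_left distrib_right)
    qed
    ultimately show ?thesis using S_iff by blast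
  qed
  moreover have "dist (f y) (f z) \<le> r * dist y z" if "y \<in> S" "z \<in> S" for y z
  proof -
    have "(y + z) * (y - z) = y * y - z * z"
      using comm[OF that] by (simp add: algebra_simps)
    then have "norm (y * y - z * z) \<le> norm (y + z) * norm (y - z)"
      by (metis norm_mult_ineq)
    also have "\<dots> \<le> (r + r) * norm (y - z)"
    proof (rule mult_right_mono)
      have "norm y \<le> r" "norm z \<le> r" using that S_iff by blast+
      then show "norm (y + z) \<le> r + r" by (rule norm_triangle_mono)
    qed simp
    finally have "norm (y * y - z * z) \<le> 2 * (r * norm (y - z))" by simp
    moreover have "f y - f z = (1/2) *\<^sub>R (y * y - z * z)"
      by (simp add: f_def algebra_simps)
    ultimately show ?thesis by (simp add: dist_norm)
  qed
  ultimately have "\<exists>!y\<in>S. f y = y"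
    using \<open>0 \<in> S\<close> r \<open>complete S\<close> by (intro Banach_fix[where c = r]) blast+
  then obtain y where y: "y \<in> S" "f y = y" by blast
  have "2 *\<^sub>R f y = b + y * y" by (simp add: f_def)
  with y have yy: "y + y = b + y * y" by (simp add: scaleR_2)
  have "adj y = y" using y S_iff by blast
  show ?thesis
  proof
    show "adj (1 - y) = 1 - y" using \<open>adj y = y\<close> by (simp add: adj_diff)
    have "(1 - y) * (1 - y) = 1 + y * y - (y + y)" by (simp add: algebra_simps)
    then show "(1 - y) * (1 - y) = 1 - b" by (simp add: yy)
    show "z * (1 - y) = (1 - y) * z" if "z * b = b * z" for z
    proof -
      have "z * y = y * z" using y that S_iff by blast
      then show ?thesis by (simp add: algebra_simps)
    qed
  qed
qed

text \<open>Rescaling by \<open>1 / M\<close> reduces this to \<open>sqrt_one_minus\<close>. The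
  third clause does the work of functional calculus: roots of commuting elements can be shown to
  commute.\<close>

lemma sqrt_diff:
  fixes a :: "'a::cstar_algebra"
  assumes a: "adj a = a" "norm a < M"
  obtains s where "adj s = s" "s * s = M *\<^sub>R 1 - a" "\<And>z. z * a = a * z \<Longrightarrow> z * s = s * z"
proof -
  have M: "M > 0" using a norm_ge_zero[of a] by linarith
  have "adj ((1/M) *\<^sub>R a) = (1/M) *\<^sub>R a" "norm ((1/M) *\<^sub>R a) < 1"
    using a M by (auto simp: adj_scaleR)
  then obtain s where s: "adj s = s" "s * s = 1 - (1/M) *\<^sub>R a"
    "\<And>z. z * ((1/M) *\<^sub>R a) = ((1/M) *\<^sub>R a) * z \<Longrightarrow> z * s = s * z"
    by (rule sqrt_one_minus) blast
  show ?thesis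
  proof
    show "adj (sqrt M *\<^sub>R s) = sqrt M *\<^sub>R s" using s(1) by (simp add: adj_scaleR)
    show "(sqrt M *\<^sub>R s) * (sqrt M *\<^sub>R s) = M *\<^sub>R 1 - a"
      using s(2) M by (simp add: scaleR_diff_right)
    show "z * (sqrt M *\<^sub>R s) = sqrt M *\<^sub>R s * z" if "z * a = a * z" for z
      using s(3)[of z] that by simp
  qed
qed

text \<open>The element \<open>s + \<i> y\<close> is a multiple of a unitary, and \<open>s\<close> is its real part.\<close>

lemma norm_le_of_sum_squares:
  fixes s y :: "'a::cstar_algebra"
  assumes "adj s = s" "adj y = y" "s * y = y * s" "s * s + y * y = M *\<^sub>R 1"
  shows "(norm s)\<^sup>2 \<le> \<bar>M\<bar>"
proof -
  define u where "u = s + \<i> *\<^sub>C y"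
  have "adj u * u = s * s + y * y"
    using assms by (simp add: u_def adj_add adj_scaleC scaleC_minus_left distrib_left distrib_right
        mult_scaleC_left mult_scaleC_right scaleC_diff_right scaleC_add_right scaleC_ii left_diff_distrib)
  then have "(norm u)\<^sup>2 = \<bar>M\<bar>" using assms by (simp flip: cstar_identity)
  moreover have "norm s \<le> norm u"
    using norm_rpart[of u] assms by (simp add: u_def rpart_sum_sa)
  ultimately show ?thesis by (metis norm_ge_zero power_mono)
qed

text \<open>Positivity, expressed by the norm alone so that closure under addition is immediate.\<close>

definition psd :: "'a::cstar_algebra \<Rightarrow> bool" where
  "psd x \<longleftrightarrow> adj x = x \<and> (\<exists>M. norm (M *\<^sub>R 1 - x) \<le> M)"

lemma psd_add: "psd x \<Longrightarrow> psd y \<Longrightarrow> psd (x + y)"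
proof -
  assume "psd x" "psd y"
  then obtain M N where "adj x = x" "adj y = y" and
    MN: "norm (M *\<^sub>R 1 - x) \<le> M" "norm (N *\<^sub>R 1 - y) \<le> N" by (auto simp: psd_def)
  moreover have "norm ((M + N) *\<^sub>R 1 - (x + y)) \<le> M + N"
    using norm_triangle_mono[OF MN] by (simp add: algebra_simps)
  ultimately show ?thesis unfolding psd_def by (metis adj_add)
qed

lemma psd_norm_minus: "adj x = x \<Longrightarrow> psd (norm x *\<^sub>R 1 - x)"
  unfolding psd_def by (auto simp: adj_diff adj_scaleR intro!: exI[of _ "norm x"])

text \<open>A root \<open>y\<close> of \<open>M - s * s\<close> commutes with \<open>s\<close>, so
  \<open>y + \<i> *\<^sub>C s\<close> is a multiple of a unitary with real part \<open>y\<close>.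
  Hence \<open>norm (M - s * s) = (norm y)\<^sup>2\<close> is at most \<open>M\<close>.\<close>

lemma psd_square:
  fixes s :: "'a::cstar_algebra"
  assumes s: "adj s = s"
  shows "psd (s * s)"
proof -
  define M where "M = norm (s * s) + 1"
  have M: "norm (s * s) < M" by (simp add: M_def)
  have "adj (s * s) = s * s" by (simp add: s adj_mult)
  then obtain y where y: "adj y = y" "y * y = M *\<^sub>R 1 - s * s"
    "\<And>z. z * (s * s) = s * s * z \<Longrightarrow> z * y = y * z"
    using M by (rule sqrt_diff) blast
  have "y * s = s * y" using y(3)[of s] by (simp add: mult.assoc)
  then have "(norm y)\<^sup>2 \<le> \<bar>M\<bar>"
    using norm_le_of_sum_squares[of y s M] y(1,2) s by simp
  then have "norm (M *\<^sub>R 1 - s * s) \<le> M"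
    using norm_square_sa[OF y(1)] y(2) by (simp add: M_def)
  then show ?thesis using s by (auto simp: psd_def adj_mult)
qed

text \<open>Since \<open>x + e = (M + e) - (M - x)\<close>, a root comes from
  \<open>sqrt_diff\<close>. The shift by \<open>e\<close> supplies the strict inequality required
  there and is removed at the end of \<open>norm_le_of_psd\<close>.\<close>

lemma sqrt_psd:
  fixes x :: "'a::cstar_algebra"
  assumes x: "psd x" and "e > 0"
  obtains s where "adj s = s" "s * s = x + e *\<^sub>R 1" "\<And>z. z * x = x * z \<Longrightarrow> z * s = s * z"
proof -
  from x obtain M where M: "norm (M *\<^sub>R 1 - x) \<le> M" and a: "adj x = x" by (auto simp: psd_def)
  have "adj (M *\<^sub>R 1 - x) = M *\<^sub>R 1 - x" "norm (M *\<^sub>R 1 - x) < M + e"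
    using a M \<open>e > 0\<close> by (auto simp: adj_diff adj_scaleR)
  then obtain s where s: "adj s = s" "s * s = (M + e) *\<^sub>R 1 - (M *\<^sub>R 1 - x)"
    "\<And>z. z * (M *\<^sub>R 1 - x) = (M *\<^sub>R 1 - x) * z \<Longrightarrow> z * s = s * z"
    by (rule sqrt_diff) blast
  have "z * s = s * z" if "z * x = x * z" for z
    using s(3)[of z] that by (simp add: algebra_simps)
  moreover have "s * s = x + e *\<^sub>R 1" using s(2) by (simp add: algebra_simps)
  ultimately show ?thesis using that s(1) by blast
qed

text \<open>With \<open>s\<^sup>2 = R + e - c\<close> and \<open>t\<^sup>2 = R + e + c\<close> one has \<open>c\<^sup>2 + (s t)\<^sup>2 = (R + e)\<^sup>2\<close>.\<close>

lemma norm_le_of_psd: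
  fixes c :: "'a::cstar_algebra"
  assumes c: "adj c = c" and p: "psd (R *\<^sub>R 1 - c)" "psd (R *\<^sub>R 1 + c)" and R: "R \<ge> 0"
  shows "norm c \<le> R"
proof (rule field_le_epsilon)
  fix e :: real assume e: "e > 0"
  obtain s where s: "adj s = s" "s * s = (R *\<^sub>R 1 - c) + e *\<^sub>R 1"
    "\<And>z. z * (R *\<^sub>R 1 - c) = (R *\<^sub>R 1 - c) * z \<Longrightarrow> z * s = s * z"
    by (rule sqrt_psd[OF p(1) e]) blast
  obtain t where t: "adj t = t" "t * t = (R *\<^sub>R 1 + c) + e *\<^sub>R 1"
    "\<And>z. z * (R *\<^sub>R 1 + c) = (R *\<^sub>R 1 + c) * z \<Longrightarrow> z * t = t * z"
    by (rule sqrt_psd[OF p(2) e]) blast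
  have cs: "c * s = s * c" using s(3)[of c] by (simp add: algebra_simps)
  have ct: "c * t = t * c" using t(3)[of c] by (simp add: algebra_simps)
  \<comment> \<open>By \<open>cs\<close>, \<open>s\<close> commutes with \<open>R + c\<close>, hence
    with the root \<open>t\<close>.\<close>
  have st: "s * t = t * s" using t(3)[of s] cs by (simp add: algebra_simps)
  have "(s * t) * (s * t) = (s * s) * (t * t)" by (metis mult.assoc st)
  also have "\<dots> = ((R + e) *\<^sub>R 1 - c) * ((R + e) *\<^sub>R 1 + c)"
    by (simp add: s(2) t(2) algebra_simps)
  also have "\<dots> = ((R + e) * (R + e)) *\<^sub>R 1 - c * c"
    by (simp add: left_diff_distrib distrib_left scaleR_diff_right)
  finally have "c * c + (s * t) * (s * t) = ((R + e) * (R + e)) *\<^sub>R 1" by simp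
  moreover have "c * (s * t) = (s * t) * c" by (metis cs ct mult.assoc)
  moreover have "adj (s * t) = s * t" using s(1) t(1) st by (simp add: adj_mult)
  ultimately have "(norm c)\<^sup>2 \<le> \<bar>(R + e) * (R + e)\<bar>" using c by (intro norm_le_of_sum_squares)
  then have "(norm c)\<^sup>2 \<le> (R + e)\<^sup>2" by (simp add: power2_eq_square)
  then show "norm c \<le> R + e" by (rule power2_le_imp_le) (use R e in linarith)
qed

text \<open>With \<open>R = norm (a * a + b * b)\<close>, the element \<open>R - a * a\<close> is
  the sum of the positive elements \<open>R - (a * a + b * b)\<close> and \<open>b * b\<close>,
  while \<open>R + a * a\<close> is a sum of two squares, \<open>R\<close> being the square of
  \<open>sqrt R\<close>.\<close>

lemma norm_square_le_sum_squares:
  fixes a b :: "'a::cstar_algebra"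
  assumes a: "adj a = a" and b: "adj b = b"
  shows "norm (a * a) \<le> norm (a * a + b * b)"
proof -
  let ?R = "norm (a * a + b * b)"
  have "psd (?R *\<^sub>R 1 - (a * a + b * b))"
    by (rule psd_norm_minus) (simp add: a b adj_add adj_mult)
  from psd_add[OF this psd_square[OF b]] have "psd (?R *\<^sub>R 1 - a * a)" by simp
  moreover have "psd (?R *\<^sub>R 1 + a * a)"
    using psd_square[OF a] psd_square[of "sqrt ?R *\<^sub>R 1 :: 'a"]
    by (intro psd_add) (auto simp: adj_scaleR)
  ultimately show ?thesis using a by (intro norm_le_of_psd) (auto simp: adj_mult)
qed

section \<open>Commutative subalgebras and associative Jordan subalgebras\<close>

lemma jordan_comm: "a * b = b * a \<Longrightarrow> a \<circ>\<^sub>J b = (a * b :: 'a::cstar_algebra)"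
  by (simp add: jordan_def flip: scaleR_2)

lemma jordan_self: "a \<circ>\<^sub>J a = (a * a :: 'a::cstar_algebra)"
  by (simp add: jordan_comm)

lemma jordan_commute: "a \<circ>\<^sub>J b = b \<circ>\<^sub>J (a::'a::cstar_algebra)"
  by (simp add: jordan_def add.commute)

lemma adj_jordan: "adj a = a \<Longrightarrow> adj b = b \<Longrightarrow> adj (a \<circ>\<^sub>J b) = a \<circ>\<^sub>J b"
  by (simp add: jordan_def adj_scaleR adj_add adj_mult add.commute)

lemma closed_sa: "closed (sa :: 'a::cstar_algebra set)"
  unfolding sa_part_def by (simp add: closed_Collect_eq continuous_intros)

lemma subspace_sa: "subspace (sa :: 'a::cstar_algebra set)"
  by (auto simp: subspace_def adj_add adj_scaleR)

text \<open>The Jordan identity is an expansion of associative products, the norm of a square is the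
  C*-identity, and the last axiom is \<open>norm_square_le_sum_squares\<close>.\<close>

lemma unital_jb_algebra_sa: "unital_jb_algebra (sa :: 'a::cstar_algebra set) (\<circ>\<^sub>J) 1"
proof -
  have "norm (a \<circ>\<^sub>J b) \<le> norm a * norm b" for a b :: 'a
  proof -
    have "norm (a * b + b * a) \<le> norm a * norm b + norm b * norm a"
      by (intro norm_triangle_mono norm_mult_ineq)
    then show ?thesis by (simp add: jordan_def mult.commute)
  qed
  moreover have "(a \<circ>\<^sub>J b) \<circ>\<^sub>J (a * a) = a \<circ>\<^sub>J (b \<circ>\<^sub>J (a * a))" for a b :: 'a
    by (simp add: jordan_def algebra_simps)
  moreover have "(a + b) \<circ>\<^sub>J c = a \<circ>\<^sub>J c + b \<circ>\<^sub>J c" for a b c :: 'a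
    by (simp add: jordan_def algebra_simps)
  moreover have "(r *\<^sub>R a) \<circ>\<^sub>J b = r *\<^sub>R (a \<circ>\<^sub>J b)" for r and a b :: 'a
    by (simp add: jordan_def algebra_simps)
  ultimately show ?thesis
    unfolding unital_jb_algebra_def
    using closed_sa subspace_sa
    by (simp add: complete_eq_closed jordan_self adj_jordan jordan_commute jordan_comm norm_square_sa
        norm_square_le_sum_squares flip: norm_square_sa)
qed

lemma comm_subalgebrasD:
  assumes "C \<in> comm_subalgebras"
  shows "1 \<in> C" "x \<in> C \<Longrightarrow> y \<in> C \<Longrightarrow> x + y \<in> C" "x \<in> C \<Longrightarrow> c *\<^sub>C x \<in> C"
    "x \<in> C \<Longrightarrow> r *\<^sub>R x \<in> C" "x \<in> C \<Longrightarrow> y \<in> C \<Longrightarrow> x - y \<in> C"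
    "x \<in> C \<Longrightarrow> y \<in> C \<Longrightarrow> x * y \<in> C" "x \<in> C \<Longrightarrow> y \<in> C \<Longrightarrow> x * y = y * x"
    "x \<in> C \<Longrightarrow> adj x \<in> C" "complete C" "x \<in> C \<Longrightarrow> rpart x \<in> sa_part C" "x \<in> C \<Longrightarrow> ipart x \<in> sa_part C"
proof -
  note C = assms[unfolded comm_subalgebras_def unital_cstar_subalgebra_def mem_Collect_eq]
  show "1 \<in> C" "complete C" using C by blast+
  show add: "x + y \<in> C" if "x \<in> C" "y \<in> C" for x y using C that by blast
  show "x * y \<in> C" if "x \<in> C" "y \<in> C" for x y using C that by blast
  show "x * y = y * x" if "x \<in> C" "y \<in> C" for x y using C that by blast
  show adj: "adj x \<in> C" if "x \<in> C" for x using C that by blast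
  show sC: "c *\<^sub>C x \<in> C" if "x \<in> C" for c x using C that by blast
  show sR: "r *\<^sub>R x \<in> C" if "x \<in> C" for r x using sC[OF that] by (simp add: scaleR_eq_scaleC)
  show diff: "x - y \<in> C" if "x \<in> C" "y \<in> C" for x y
    using add[OF that(1) sR[OF that(2), of "- 1"]] by simp
  show "rpart x \<in> sa_part C" if "x \<in> C" for x
    using that by (simp add: sa_part_def) (simp add: rpart_def add sR adj)
  show "ipart x \<in> sa_part C" if "x \<in> C" for x
    using that by (simp add: sa_part_def) (simp only: ipart_def diff sR adj sC)
qed

text \<open>Inside a commutative \<open>C\<close> the Jordan product is the given product, so
  associativity is inherited; completeness follows because \<open>sa\<close> is closed.\<close>

lemma assoc_subalgebra_sa_part:
  fixes C :: "'a::cstar_algebra set"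
  assumes C: "C \<in> comm_subalgebras"
  shows "banach_unital_assoc_subalgebra sa (\<circ>\<^sub>J) 1 (sa_part C)"
proof -
  note CD = comm_subalgebrasD[OF C]
  have jm: "a \<circ>\<^sub>J b = a * b" if "a \<in> C" "b \<in> C" for a b
    using CD(7)[OF that] by (rule jordan_comm)
  have "sa_part C = C \<inter> sa" by (auto simp: sa_part_def)
  then have "complete (sa_part C)"
    using CD(9) by (simp add: complete_eq_closed closed_Int[OF _ closed_sa])
  moreover have "0 \<in> C" using CD(4)[OF CD(1), of 0] by simp
  then have "subspace (sa_part C)"
    using CD by (auto simp: subspace_def sa_part_def adj_add adj_scaleR)
  moreover have "a \<circ>\<^sub>J b \<in> sa_part C" if "a \<in> sa_part C" "b \<in> sa_part C" for a b
  proof -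
    have "a \<in> C" "b \<in> C" "adj a = a" "adj b = b" using that by (auto simp: sa_part_def)
    then show ?thesis using adj_jordan[of a b] by (simp add: sa_part_def jm CD(6))
  qed
  moreover have "(a \<circ>\<^sub>J b) \<circ>\<^sub>J c = a \<circ>\<^sub>J (b \<circ>\<^sub>J c)"
    if "a \<in> sa_part C" "b \<in> sa_part C" "c \<in> sa_part C" for a b c
  proof -
    have "a \<in> C" "b \<in> C" "c \<in> C" using that by (auto simp: sa_part_def)
    then show ?thesis by (simp add: jm CD(6) mult.assoc)
  qed
  ultimately show ?thesis
    unfolding banach_unital_assoc_subalgebra_def using CD(1)
    by (simp add: sa_part_def subset_iff)
qed

text \<open>The bicommutant of a self-adjoint element is commutative.\<close>

lemma sa_in_comm_subalgebra:
  fixes a :: "'a::cstar_algebra"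
  assumes a: "adj a = a"
  obtains C where "C \<in> comm_subalgebras" "a \<in> sa_part C"
proof
  \<comment> \<open>With the bicommutant, in place of the closure of the polynomials in
    \<open>a\<close>, each algebraic closure property is a commutation identity.\<close>
  define C where "C = {x. \<forall>z. z * a = a * z \<longrightarrow> z * x = x * z}"
  have C: "z * x = x * z" if "x \<in> C" "z * a = a * z" for x z
    using that by (simp only: C_def mem_Collect_eq)
  have CI: "x \<in> C" if "\<And>z. z * a = a * z \<Longrightarrow> z * x = x * z" for x
    unfolding C_def using that by blast
  have "closed C" unfolding C_def
    by (intro closed_Collect_all closed_Collect_imp open_Collect_const closed_Collect_eq
        continuous_intros)
  then have "complete C" by (simp add: complete_eq_closed)
  moreover have "1 \<in> C" by (rule CI) simp
  moreover have "x + y \<in> C" "x * y \<in> C" if "x \<in> C" "y \<in> C" for x y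
  proof -
    show "x + y \<in> C"
      by (rule CI) (simp only: distrib_left distrib_right C[OF that(1)] C[OF that(2)])
    show "x * y \<in> C"
      by (rule CI) (metis C[OF that(1)] C[OF that(2)] mult.assoc)
  qed
  moreover have "c *\<^sub>C x \<in> C" if "x \<in> C" for c x
    by (rule CI) (simp only: mult_scaleC_left mult_scaleC_right C[OF that])
  \<comment> \<open>The commutant of a self-adjoint \<open>a\<close> is closed under
    \<open>adj\<close>, so \<open>adj z\<close> may be used as the test element.\<close>
  moreover have "adj x \<in> C" if "x \<in> C" for x
  proof (rule CI)
    fix z assume "z * a = a * z"
    then have "adj z * a = a * adj z" by (metis a adj_mult)
    then have "adj z * x = x * adj z" by (rule C[OF that])
    then show "z * adj x = adj x * z" by (metis adj_adj adj_mult)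
  qed
  \<comment> \<open>The test element \<open>a\<close> shows that \<open>x\<close> commutes with
    \<open>a\<close>, so \<open>x\<close> can be the test element for \<open>y\<close>.\<close>
  moreover have "x * y = y * x" if "x \<in> C" "y \<in> C" for x y
    using C[OF that(1), of a] C[OF that(2), of x] by simp
  ultimately show "C \<in> comm_subalgebras"
    by (simp add: comm_subalgebras_def unital_cstar_subalgebra_def)
  show "a \<in> sa_part C" using a CI by (simp add: sa_part_def)
qed

text \<open>The associator of \<open>a, c, b\<close> is a multiple of \<open>[c, [a, b]]\<close>. If \<open>d = [a, b]\<close> commutes with
  \<open>a\<close> and \<open>b\<close>, then \<open>[a, [a, b\<^sup>2]] = 2 d\<^sup>2\<close>, and a skew-adjoint \<open>d\<close> with \<open>d\<^sup>2 = 0\<close> vanishes.\<close>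

lemma jordan_assoc_imp_commute:
  fixes W :: "'a::cstar_algebra set"
  assumes W: "W \<subseteq> sa" "\<And>a b. a \<in> W \<Longrightarrow> b \<in> W \<Longrightarrow> a \<circ>\<^sub>J b \<in> W"
    and assoc: "\<And>a b c. a \<in> W \<Longrightarrow> b \<in> W \<Longrightarrow> c \<in> W \<Longrightarrow> (a \<circ>\<^sub>J b) \<circ>\<^sub>J c = a \<circ>\<^sub>J (b \<circ>\<^sub>J c)"
    and a: "a \<in> W" and b: "b \<in> W"
  shows "a * b = b * a"
proof -
  have comm: "z * (x * y - y * x) = (x * y - y * x) * z" if "x \<in> W" "y \<in> W" "z \<in> W" for x y z
  proof -
    have "(x * z + z * x) * y + y * (x * z + z * x) = 4 *\<^sub>R ((x \<circ>\<^sub>J z) \<circ>\<^sub>J y)"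
      by (simp add: jordan_def algebra_simps)
    also have "\<dots> = 4 *\<^sub>R (x \<circ>\<^sub>J (z \<circ>\<^sub>J y))" using assoc that by simp
    also have "\<dots> = x * (z * y + y * z) + (z * y + y * z) * x"
      by (simp add: jordan_def algebra_simps)
    finally show ?thesis by (simp add: algebra_simps)
  qed
  define d where "d = a * b - b * a"
  have ad: "a * d = d * a" and bd: "b * d = d * b"
    using comm a b by (auto simp: d_def)
  \<comment> \<open>Squares stay in \<open>W\<close>, so \<open>comm\<close> also applies to the
    commutator of \<open>a\<close> with \<open>b * b\<close>.\<close>
  have "b * b \<in> W" using W(2)[OF b b] by (simp add: jordan_self)
  then have *: "a * (a * (b * b) - b * b * a) = (a * (b * b) - b * b * a) * a"
    using comm a by blast
  have "a * (b * b) - b * b * a = d * b + b * d" by (simp add: d_def algebra_simps)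
  also have "\<dots> = 2 *\<^sub>R (d * b)" by (simp add: bd scaleR_2)
  finally have "a * (d * b) = d * b * a" using * by simp
  moreover have "a * (d * b) = d * (a * b)" by (metis ad mult.assoc)
  ultimately have "d * d = 0" by (simp add: d_def mult.assoc right_diff_distrib)
  moreover have "adj d = - d"
    using subsetD[OF W(1) a] subsetD[OF W(1) b] by (simp add: d_def adj_diff adj_mult)
  ultimately have "adj d * d = 0" by simp
  then have "norm d = 0" using cstar_identity[of d] by simp
  then show ?thesis by (simp add: d_def)
qed

section \<open>Complexification of associative Jordan subalgebras\<close>

lemma rpart_scaleC: "rpart (c *\<^sub>C x) = Re c *\<^sub>R rpart x - Im c *\<^sub>R ipart x"
  by (subst scaleC_Re_Im) (simp add: rpart_add rpart_scaleR rpart_ii)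

lemma ipart_scaleC: "ipart (c *\<^sub>C x) = Re c *\<^sub>R ipart x + Im c *\<^sub>R rpart x"
  by (subst scaleC_Re_Im) (simp add: ipart_add ipart_scaleR ipart_ii)

lemma rpart_ipart_eqI: "rpart x = rpart y \<Longrightarrow> ipart x = ipart y \<Longrightarrow> x = y"
  by (metis rpart_ipart)

lemma mult_parts:
  fixes x y :: "'a::cstar_algebra"
  shows "x * y = (rpart x * rpart y - ipart x * ipart y)
           + \<i> *\<^sub>C (rpart x * ipart y + ipart x * rpart y)"
proof -
  have "x * y = (rpart x + \<i> *\<^sub>C ipart x) * (rpart y + \<i> *\<^sub>C ipart y)"
    by (simp only: rpart_ipart)
  also have "\<dots> = (rpart x * rpart y - ipart x * ipart y)
           + \<i> *\<^sub>C (rpart x * ipart y + ipart x * rpart y)"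
    by (simp add: distrib_left distrib_right mult_scaleC_left mult_scaleC_right scaleC_add_right
        scaleC_ii)
  finally show ?thesis .
qed

text \<open>Commutation makes the two brackets in \<open>mult_parts\<close> self-adjoint, so they
  are the parts of the product.\<close>

lemma rpart_ipart_mult_comm:
  fixes x y :: "'a::cstar_algebra"
  assumes "rpart x * rpart y = rpart y * rpart x" "ipart x * ipart y = ipart y * ipart x"
    "rpart x * ipart y = ipart y * rpart x" "ipart x * rpart y = rpart y * ipart x"
  shows "rpart (x * y) = rpart x * rpart y - ipart x * ipart y"
    and "ipart (x * y) = rpart x * ipart y + ipart x * rpart y"
proof -
  have "adj (rpart x * rpart y - ipart x * ipart y) = rpart x * rpart y - ipart x * ipart y"
    "adj (rpart x * ipart y + ipart x * rpart y) = rpart x * ipart y + ipart x * rpart y"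
    by (simp_all add: adj_diff adj_add adj_mult flip: assms)
  then show "rpart (x * y) = rpart x * rpart y - ipart x * ipart y"
    "ipart (x * y) = rpart x * ipart y + ipart x * rpart y"
    by (simp_all only: mult_parts[of x y] rpart_sum_sa ipart_sum_sa)
qed

text \<open>For \<open>J \<subseteq> sa\<close> this is \<open>J + \<i> J\<close>. In this preimage
  form closedness follows from continuity of the two parts.\<close>

definition complexification :: "'a::cstar_algebra set \<Rightarrow> 'a set" where
  "complexification J = {x. rpart x \<in> J \<and> ipart x \<in> J}"

lemma assoc_subalgebra_commute:
  assumes "banach_unital_assoc_subalgebra sa (\<circ>\<^sub>J) 1 J" "a \<in> J" "b \<in> J"
  shows "a * b = b * a"
  using assms unfolding banach_unital_assoc_subalgebra_def
  by (intro jordan_assoc_imp_commute[of J]) auto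

lemma assoc_subalgebra_mult:
  assumes J: "banach_unital_assoc_subalgebra sa (\<circ>\<^sub>J) 1 J" and "a \<in> J" "b \<in> J"
  shows "a * b \<in> J"
  using jordan_comm[OF assoc_subalgebra_commute[OF assms]] assms
  unfolding banach_unital_assoc_subalgebra_def by metis

text \<open>The crux is closure under products. Elements of \<open>J\<close> commute, so the parts
  of \<open>x * y\<close> are combinations of associative products of elements of \<open>J\<close>;
  these coincide with Jordan products and stay in \<open>J\<close>.\<close>

lemma complexification_comm_subalgebra:
  fixes J :: "'a::cstar_algebra set"
  assumes J: "banach_unital_assoc_subalgebra sa (\<circ>\<^sub>J) 1 J"
  shows "complexification J \<in> comm_subalgebras"
proof -
  have sub: "subspace J" and "complete J" and "1 \<in> J"
    using J by (auto simp: banach_unital_assoc_subalgebra_def)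
  note comm = assoc_subalgebra_commute[OF J]
  have "complexification J = rpart -` J \<inter> ipart -` J"
    by (auto simp: complexification_def)
  then have "closed (complexification J)"
    using \<open>complete J\<close> continuous_rpart continuous_ipart
    by (metis closed_Int closed_vimage complete_imp_closed)
  moreover have "x * y = y * x" "x * y \<in> complexification J"
    if "x \<in> complexification J" "y \<in> complexification J" for x y
  proof -
    have p: "rpart x \<in> J" "ipart x \<in> J" "rpart y \<in> J" "ipart y \<in> J"
      using that by (auto simp: complexification_def)
    note c = comm[OF p(1,3)] comm[OF p(2,4)] comm[OF p(1,4)] comm[OF p(2,3)]
    note xy = rpart_ipart_mult_comm[OF c]
    note yx = rpart_ipart_mult_comm[OF c(1)[symmetric] c(2)[symmetric] c(4)[symmetric] c(3)[symmetric]]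
    show "x * y = y * x"
      by (rule rpart_ipart_eqI) (simp_all only: xy yx c add.commute)
    show "x * y \<in> complexification J"
      unfolding complexification_def mem_Collect_eq xy
      by (intro conjI subspace_diff[OF sub] subspace_add[OF sub] assoc_subalgebra_mult[OF J] p)
  qed
  ultimately show ?thesis
    using sub \<open>1 \<in> J\<close>
    by (auto simp: comm_subalgebras_def unital_cstar_subalgebra_def complete_eq_closed
        complexification_def rpart_add ipart_add rpart_scaleC ipart_scaleC rpart_adj ipart_adj
        subspace_0 subspace_neg intro!: subspace_diff subspace_add subspace_scale)
qed

lemma sa_part_complexification:
  assumes J: "banach_unital_assoc_subalgebra sa (\<circ>\<^sub>J) 1 J"
  shows "sa_part (complexification J) = J"
proof -
  have "J \<subseteq> sa" "0 \<in> J"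
    using J by (auto simp: banach_unital_assoc_subalgebra_def subspace_0)
  then show ?thesis by (auto simp: sa_part_def complexification_def)
qed

lemma complexification_sa_part:
  assumes C: "C \<in> comm_subalgebras"
  shows "complexification (sa_part C) = C"
proof (intro set_eqI iffI)
  fix x assume "x \<in> complexification (sa_part C)"
  then have "rpart x \<in> C" "ipart x \<in> C" by (auto simp: complexification_def sa_part_def)
  then have "rpart x + \<i> *\<^sub>C ipart x \<in> C" using comm_subalgebrasD(2,3)[OF C] by blast
  then show "x \<in> C" by (simp only: rpart_ipart)
qed (use comm_subalgebrasD[OF C] in \<open>simp add: complexification_def\<close>)

lemma complexification_eq:
  assumes "J \<subseteq> sa"
  shows "complexification J = {a + \<i> *\<^sub>C b | a b. a \<in> J \<and> b \<in> J}"
proof (intro set_eqI iffI)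
  fix x assume "x \<in> complexification J"
  then have "rpart x \<in> J" "ipart x \<in> J" by (auto simp: complexification_def)
  moreover have "x = rpart x + \<i> *\<^sub>C ipart x" by (simp only: rpart_ipart)
  ultimately show "x \<in> {a + \<i> *\<^sub>C b | a b. a \<in> J \<and> b \<in> J}" by blast
next
  fix x assume "x \<in> {a + \<i> *\<^sub>C b | a b. a \<in> J \<and> b \<in> J}"
  then obtain a b where ab: "x = a + \<i> *\<^sub>C b" "a \<in> J" "b \<in> J" by blast
  moreover have "adj a = a" "adj b = b" using ab assms by auto
  ultimately show "x \<in> complexification J"
    by (simp add: complexification_def rpart_sum_sa ipart_sum_sa)
qed

lemma bij_betw_sa_part:
  "bij_betw sa_part (comm_subalgebras :: 'a::cstar_algebra set set)
     {J. banach_unital_assoc_subalgebra sa (\<circ>\<^sub>J) 1 J}"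
  by (rule bij_betw_byWitness[where f' = complexification])
    (auto simp: complexification_sa_part sa_part_complexification assoc_subalgebra_sa_part
      complexification_comm_subalgebra)

lemma sa_part_subset_iff:
  assumes "C \<in> comm_subalgebras" "D \<in> comm_subalgebras"
  shows "C \<subseteq> D \<longleftrightarrow> sa_part C \<subseteq> sa_part D"
proof
  assume "sa_part C \<subseteq> sa_part D"
  then have "complexification (sa_part C) \<subseteq> complexification (sa_part D)"
    by (auto simp: complexification_def)
  then show "C \<subseteq> D" by (simp only: complexification_sa_part assms)
qed (auto simp: sa_part_def)


section \<open>Complex linear extension\<close>

text \<open>The unique complex linear extension, if \<open>\<phi>\<close> is real linear on
  \<open>sa\<close>. It evaluates \<open>\<phi>\<close> at self-adjoint elements only, so functions
  that are \<open>undefined\<close> outside \<open>sa\<close> can be extended too.\<close>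

definition cext :: "('a::cstar_algebra \<Rightarrow> 'b::cstar_algebra) \<Rightarrow> 'a \<Rightarrow> 'b" where
  "cext \<phi> x = \<phi> (rpart x) + \<i> *\<^sub>C \<phi> (ipart x)"

text \<open>The general target lets the same rules serve maps between algebras and both real and
  complex functionals.\<close>

definition sa_linear :: "('a::cstar_algebra \<Rightarrow> 'b::real_vector) \<Rightarrow> bool" where
  "sa_linear \<phi> \<longleftrightarrow> (\<forall>a\<in>sa. \<forall>b\<in>sa. \<phi> (a + b) = \<phi> a + \<phi> b) \<and> (\<forall>r. \<forall>a\<in>sa. \<phi> (r *\<^sub>R a) = r *\<^sub>R \<phi> a)"

lemma sa_linearD:
  assumes "sa_linear \<phi>"
  shows "adj a = a \<Longrightarrow> adj b = b \<Longrightarrow> \<phi> (a + b) = \<phi> a + \<phi> b"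
    "adj a = a \<Longrightarrow> \<phi> (r *\<^sub>R a) = r *\<^sub>R \<phi> a"
    "adj a = a \<Longrightarrow> \<phi> (- a) = - \<phi> a"
    "adj a = a \<Longrightarrow> adj b = b \<Longrightarrow> \<phi> (a - b) = \<phi> a - \<phi> b"
    "\<phi> 0 = 0"
proof -
  show add: "\<phi> (a + b) = \<phi> a + \<phi> b" if "adj a = a" "adj b = b" for a b
    using assms that by (simp add: sa_linear_def)
  show sR: "\<phi> (r *\<^sub>R a) = r *\<^sub>R \<phi> a" if "adj a = a" for r a
    using assms that by (simp add: sa_linear_def)
  show neg: "\<phi> (- a) = - \<phi> a" if "adj a = a" for a
    using sR[OF that, of "- 1"] by simp
  show "\<phi> (a - b) = \<phi> a - \<phi> b" if "adj a = a" "adj b = b" for a b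
    using add[of a "- b"] that by (simp add: neg adj_minus)
  show "\<phi> 0 = 0" using sR[of 0 0] by simp
qed

lemma cext_sa: "sa_linear \<phi> \<Longrightarrow> adj a = a \<Longrightarrow> cext \<phi> a = \<phi> a"
  by (simp add: cext_def sa_linearD)

lemma cext_add: "sa_linear \<phi> \<Longrightarrow> cext \<phi> (x + y) = cext \<phi> x + cext \<phi> y"
  by (simp add: cext_def rpart_add ipart_add sa_linearD scaleC_add_right)

lemma cext_scaleC:
  fixes \<phi> :: "'a::cstar_algebra \<Rightarrow> 'b::cstar_algebra"
  assumes "sa_linear \<phi>"
  shows "cext \<phi> (c *\<^sub>C x) = c *\<^sub>C cext \<phi> x"
  by (subst scaleC_Re_Im[of c "cext \<phi> x"])
    (simp add: cext_def rpart_scaleC ipart_scaleC sa_linearD[OF assms] adj_scaleR scaleC_add_right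
      scaleC_diff_right scaleC_scaleR_commute scaleC_ii algebra_simps)

lemma cext_scaleR: "sa_linear \<phi> \<Longrightarrow> cext \<phi> (r *\<^sub>R x) = r *\<^sub>R cext \<phi> x"
  by (simp add: scaleR_eq_scaleC cext_scaleC)

lemma cext_cong: "(\<And>a. adj a = a \<Longrightarrow> \<phi> a = \<psi> a) \<Longrightarrow> cext \<phi> x = cext \<psi> x"
  by (simp add: cext_def)

lemma cext_eq:
  assumes "\<And>x y. f (x + y) = f x + f y" "\<And>c x. f (c *\<^sub>C x) = c *\<^sub>C f x"
  shows "cext f x = f x"
  by (metis assms cext_def rpart_ipart)

lemma linear_isomorphism_inv:
  assumes h: "linear_isomorphism V W h" and V: "subspace V"
  shows "linear_isomorphism W V (inv_into V h)"
proof -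
  have bij: "bij_betw h V W"
    and add: "\<And>a b. a \<in> V \<Longrightarrow> b \<in> V \<Longrightarrow> h (a + b) = h a + h b"
    and sR: "\<And>r a. a \<in> V \<Longrightarrow> h (r *\<^sub>R a) = r *\<^sub>R h a"
    using h by (auto simp: linear_isomorphism_def)
  let ?g = "inv_into V h"
  have g: "h (?g w) = w" "?g w \<in> V" if "w \<in> W" for w
    using that bij by (auto simp: bij_betw_inv_into_right bij_betw_def inv_into_into)
  have hg: "?g (h v) = v" if "v \<in> V" for v
    using that bij by (simp add: bij_betw_inv_into_left)
  have "?g (a + b) = ?g a + ?g b" if "a \<in> W" "b \<in> W" for a b
    using hg[of "?g a + ?g b"] g that add V by (simp add: subspace_add)
  moreover have "?g (r *\<^sub>R a) = r *\<^sub>R ?g a" if "a \<in> W" for r a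
    using hg[of "r *\<^sub>R ?g a"] g that sR V by (simp add: subspace_scale)
  ultimately show ?thesis
    using bij_betw_inv_into[OF bij] by (simp add: linear_isomorphism_def)
qed


section \<open>Jordan isomorphisms\<close>

lemma sa_jordan_isomorphismD:
  assumes "sa_jordan_isomorphism \<Phi>"
  shows "sa_linear \<Phi>" "adj a = a \<Longrightarrow> adj (\<Phi> a) = \<Phi> a"
    "adj a = a \<Longrightarrow> adj b = b \<Longrightarrow> \<Phi> (a \<circ>\<^sub>J b) = \<Phi> a \<circ>\<^sub>J \<Phi> b"
    "adj a = a \<Longrightarrow> inv_into sa \<Phi> (\<Phi> a) = a" "adj c = c \<Longrightarrow> \<Phi> (inv_into sa \<Phi> c) = c"
    "sa_jordan_isomorphism (inv_into sa \<Phi>)" "\<Phi> 1 = 1"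
proof -
  have lin: "linear_isomorphism sa sa \<Phi>" and J: "\<forall>a\<in>sa. \<forall>b\<in>sa. \<Phi> (a \<circ>\<^sub>J b) = \<Phi> a \<circ>\<^sub>J \<Phi> b"
    using assms by (auto simp: sa_jordan_isomorphism_def)
  have bij: "bij_betw \<Phi> sa sa" using lin by (simp add: linear_isomorphism_def)
  show "sa_linear \<Phi>" using lin by (simp add: linear_isomorphism_def sa_linear_def)
  show sa: "adj (\<Phi> a) = \<Phi> a" if "adj a = a" for a
    using bij_betwE[OF bij] that by simp
  show jor: "\<Phi> (a \<circ>\<^sub>J b) = \<Phi> a \<circ>\<^sub>J \<Phi> b" if "adj a = a" "adj b = b" for a b
    using J that by simp
  let ?g = "inv_into sa \<Phi>"
  show inv: "?g (\<Phi> a) = a" if "adj a = a" for a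
    using bij that by (simp add: bij_betw_inv_into_left)
  show inv': "\<Phi> (?g b) = b" if "adj b = b" for b
    using bij that by (simp add: bij_betw_inv_into_right)
  have sa': "adj (?g b) = ?g b" if "adj b = b" for b
    using bij_betwE[OF bij_betw_inv_into[OF bij]] that by simp
  have "?g (a \<circ>\<^sub>J b) = ?g a \<circ>\<^sub>J ?g b" if "adj a = a" "adj b = b" for a b
    using inv[of "?g a \<circ>\<^sub>J ?g b"] that by (simp add: sa' adj_jordan jor inv')
  then show "sa_jordan_isomorphism ?g"
    using linear_isomorphism_inv[OF lin subspace_sa] by (simp add: sa_jordan_isomorphism_def)
  \<comment> \<open>Unitality comes from surjectivity: multiply \<open>1\<close> by the preimage of
    \<open>1\<close> and apply \<open>\<Phi>\<close>.\<close>
  have "\<Phi> 1 \<circ>\<^sub>J 1 = 1" using jor[of 1 "?g 1"] by (simp add: sa' inv' jordan_comm)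
  then show "\<Phi> 1 = 1" by (simp add: jordan_comm)
qed

text \<open>If \<open>norm a < M\<close>, then \<open>M - a\<close> and \<open>M + a\<close> are squares, hence so are their images.\<close>

lemma norm_sa_jordan_isomorphism_le:
  assumes \<Phi>: "sa_jordan_isomorphism \<Phi>" and a: "adj a = a"
  shows "norm (\<Phi> a) \<le> norm a"
proof (rule dense_ge)
  fix M assume M: "norm a < M"
  note D = sa_jordan_isomorphismD[OF \<Phi>]
  have psd: "psd (M *\<^sub>R 1 - \<Phi> b)" if b: "adj b = b" "norm b < M" for b
  proof -
    obtain s where s: "adj s = s" "s * s = M *\<^sub>R 1 - b" using sqrt_diff[OF b] by blast
    have "\<Phi> s * \<Phi> s = \<Phi> (M *\<^sub>R 1 - b)"
      using D(3)[OF s(1) s(1)] s by (simp add: jordan_self)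
    also have "\<dots> = M *\<^sub>R 1 - \<Phi> b"
      using b by (simp add: sa_linearD[OF D(1)] D(7) adj_scaleR)
    finally show ?thesis using psd_square[OF D(2)[OF s(1)]] by simp
  qed
  have "psd (M *\<^sub>R 1 - \<Phi> a)" using psd a M by blast
  moreover have "psd (M *\<^sub>R 1 + \<Phi> a)"
    using psd[of "- a"] a M by (simp add: adj_minus sa_linearD[OF D(1)])
  moreover have "M \<ge> 0" using M norm_ge_zero[of a] by linarith
  ultimately show "norm (\<Phi> a) \<le> M" using D(2)[OF a] by (intro norm_le_of_psd)
qed

lemma norm_sa_jordan_isomorphism:
  assumes \<Phi>: "sa_jordan_isomorphism \<Phi>" and a: "adj a = a"
  shows "norm (\<Phi> a) = norm a"
proof (rule antisym)
  note D = sa_jordan_isomorphismD[OF \<Phi>]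
  show "norm a \<le> norm (\<Phi> a)"
    using norm_sa_jordan_isomorphism_le[OF D(6) D(2)[OF a]] D(4)[OF a] by simp
qed (rule norm_sa_jordan_isomorphism_le[OF assms])

text \<open>Completeness of the image comes from isometry, but \<open>\<Phi>\<close> is linear on
  \<open>sa\<close> only. The argument therefore runs through \<open>cext \<Phi>\<close>, which is
  bounded linear on the whole algebra and agrees with \<open>\<Phi>\<close> on \<open>J\<close>; the
  bound 2 counts one \<open>norm x\<close> for each part.\<close>

lemma assoc_subalgebra_image:
  fixes \<Phi> :: "'a::cstar_algebra \<Rightarrow> 'b::cstar_algebra"
  assumes \<Phi>: "sa_jordan_isomorphism \<Phi>" and J: "banach_unital_assoc_subalgebra sa (\<circ>\<^sub>J) 1 J"
  shows "banach_unital_assoc_subalgebra sa (\<circ>\<^sub>J) 1 (\<Phi> ` J)"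
proof -
  note D = sa_jordan_isomorphismD[OF \<Phi>]
  note J' = J[unfolded banach_unital_assoc_subalgebra_def]
  have Jsa: "adj a = a" if "a \<in> J" for a using J' that by auto
  have ext: "cext \<Phi> a = \<Phi> a" if "a \<in> J" for a using Jsa[OF that] by (simp add: cext_sa D(1))
  have "bounded_linear (cext \<Phi>)"
  proof (rule bounded_linear_intro[where K = 2])
    fix x
    have "norm (cext \<Phi> x) \<le> norm (\<Phi> (rpart x)) + norm (\<Phi> (ipart x))"
      unfolding cext_def by (rule norm_triangle_le) (simp add: norm_scaleC)
    also have "\<dots> \<le> norm x + norm x"
      using norm_rpart[of x] norm_ipart[of x] by (simp add: norm_sa_jordan_isomorphism[OF \<Phi>])
    finally show "norm (cext \<Phi> x) \<le> norm x * 2" by simp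
  qed (simp_all add: cext_add cext_scaleR D(1))
  moreover have "\<forall>a\<in>J. 1 * norm a \<le> norm (cext \<Phi> a)"
    by (simp add: ext Jsa norm_sa_jordan_isomorphism[OF \<Phi>])
  ultimately have "complete (cext \<Phi> ` J)" "subspace (cext \<Phi> ` J)"
    using J' by (auto intro!: complete_isometric_image[of 1] linear_subspace_image
        bounded_linear.linear)
  moreover have "cext \<Phi> ` J = \<Phi> ` J" by (simp add: ext)
  moreover have "1 \<in> \<Phi> ` J" using D(7) J' by (metis imageI)
  moreover have "\<Phi> a \<circ>\<^sub>J \<Phi> b = \<Phi> (a \<circ>\<^sub>J b)" if "a \<in> J" "b \<in> J" for a b
    using that by (simp add: Jsa D(3))
  ultimately show ?thesis
    using J' by (auto simp: banach_unital_assoc_subalgebra_def Jsa D(2))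
qed

text \<open>Expresses the image of \<open>C\<close> through its self-adjoint part, so that the
  correspondence with associative Jordan subalgebras makes it a commutative C*-subalgebra.\<close>

lemma cext_image_eq:
  assumes \<Phi>: "sa_jordan_isomorphism \<Phi>" and C: "C \<in> comm_subalgebras"
  shows "cext \<Phi> ` C = complexification (\<Phi> ` sa_part C)"
proof (intro set_eqI iffI)
  note D = sa_jordan_isomorphismD[OF \<Phi>]
  fix y assume "y \<in> cext \<Phi> ` C"
  then obtain x where "x \<in> C" "y = cext \<Phi> x" by blast
  then show "y \<in> complexification (\<Phi> ` sa_part C)"
    using comm_subalgebrasD(10,11)[OF C]
    by (simp add: complexification_def cext_def rpart_sum_sa ipart_sum_sa D(2))
next
  note D = sa_jordan_isomorphismD[OF \<Phi>]
  fix y assume "y \<in> complexification (\<Phi> ` sa_part C)"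
  then obtain a b where ab: "a \<in> sa_part C" "b \<in> sa_part C" "rpart y = \<Phi> a" "ipart y = \<Phi> b"
    by (auto simp: complexification_def)
  then have sa: "a \<in> C" "b \<in> C" "adj a = a" "adj b = b" by (auto simp: sa_part_def)
  then have "cext \<Phi> (a + \<i> *\<^sub>C b) = \<Phi> a + \<i> *\<^sub>C \<Phi> b"
    by (simp add: cext_def rpart_sum_sa ipart_sum_sa)
  then have "cext \<Phi> (a + \<i> *\<^sub>C b) = y" by (metis ab(3,4) rpart_ipart)
  moreover have "a + \<i> *\<^sub>C b \<in> C" using sa comm_subalgebrasD(2,3)[OF C] by blast
  ultimately show "y \<in> cext \<Phi> ` C" by blast
qed

lemma cext_image_comm_subalgebra:
  assumes "sa_jordan_isomorphism \<Phi>" "C \<in> comm_subalgebras"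
  shows "cext \<Phi> ` C \<in> comm_subalgebras"
  unfolding cext_image_eq[OF assms]
  by (intro complexification_comm_subalgebra assoc_subalgebra_image assoc_subalgebra_sa_part assms)

lemma cext_inv:
  assumes \<Phi>: "sa_jordan_isomorphism \<Phi>"
  shows "cext (inv_into sa \<Phi>) (cext \<Phi> x) = x" "cext \<Phi> (cext (inv_into sa \<Phi>) y) = y"
proof -
  note D = sa_jordan_isomorphismD[OF \<Phi>] and D' = sa_jordan_isomorphismD[OF sa_jordan_isomorphismD(6)[OF \<Phi>]]
  show "cext (inv_into sa \<Phi>) (cext \<Phi> x) = x"
    by (simp add: cext_def rpart_sum_sa ipart_sum_sa D(2,4) rpart_ipart)
  show "cext \<Phi> (cext (inv_into sa \<Phi>) y) = y"
    by (simp add: cext_def rpart_sum_sa ipart_sum_sa D'(2) D(5) rpart_ipart)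
qed

text \<open>The image of \<open>sa_part C\<close> is again associative, so its elements commute. On
  both sides the Jordan product is then the ordinary one; \<open>\<Phi>\<close> is multiplicative on
  \<open>sa_part C\<close>, and comparing parts carries this over to \<open>C\<close>.\<close>

lemma cext_star_isomorphism:
  assumes \<Phi>: "sa_jordan_isomorphism \<Phi>" and C: "C \<in> comm_subalgebras"
  shows "unital_star_isomorphism C (cext \<Phi> ` C) (cext \<Phi>)"
proof -
  note D = sa_jordan_isomorphismD[OF \<Phi>] and CD = comm_subalgebrasD[OF C]
  have parts: "rpart (cext \<Phi> x) = \<Phi> (rpart x)" "ipart (cext \<Phi> x) = \<Phi> (ipart x)" for x
    by (simp_all add: cext_def rpart_sum_sa ipart_sum_sa D(2))
  have comm: "\<Phi> a * \<Phi> b = \<Phi> b * \<Phi> a" if "a \<in> sa_part C" "b \<in> sa_part C" for a b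
    using assoc_subalgebra_commute[OF assoc_subalgebra_image[OF \<Phi> assoc_subalgebra_sa_part[OF C]]]
      that by blast
  have mult: "\<Phi> (a * b) = \<Phi> a * \<Phi> b" and sa_mult: "adj (a * b) = a * b"
    if "a \<in> sa_part C" "b \<in> sa_part C" for a b
  proof -
    have ab: "adj a = a" "adj b = b" "a * b = b * a"
      using that CD(7) by (auto simp: sa_part_def)
    then show "\<Phi> (a * b) = \<Phi> a * \<Phi> b"
      using D(3)[OF ab(1,2)] by (simp only: jordan_comm[OF ab(3)] jordan_comm[OF comm[OF that]])
    show "adj (a * b) = a * b" by (simp only: adj_mult ab)
  qed
  have "cext \<Phi> (x * y) = cext \<Phi> x * cext \<Phi> y" if "x \<in> C" "y \<in> C" for x y
  proof -
    note p = CD(10)[OF that(1)] CD(11)[OF that(1)] CD(10)[OF that(2)] CD(11)[OF that(2)]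
    have c: "a * b = b * a" if "a \<in> sa_part C" "b \<in> sa_part C" for a b
      using that CD(7) by (auto simp: sa_part_def)
    note m = rpart_ipart_mult_comm[OF c[OF p(1,3)] c[OF p(2,4)] c[OF p(1,4)] c[OF p(2,3)]]
    have c': "rpart (cext \<Phi> x) * rpart (cext \<Phi> y) = rpart (cext \<Phi> y) * rpart (cext \<Phi> x)"
      "ipart (cext \<Phi> x) * ipart (cext \<Phi> y) = ipart (cext \<Phi> y) * ipart (cext \<Phi> x)"
      "rpart (cext \<Phi> x) * ipart (cext \<Phi> y) = ipart (cext \<Phi> y) * rpart (cext \<Phi> x)"
      "ipart (cext \<Phi> x) * rpart (cext \<Phi> y) = rpart (cext \<Phi> y) * ipart (cext \<Phi> x)"
      unfolding parts by (rule comm; rule p)+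
    note m' = rpart_ipart_mult_comm[OF c']
    show ?thesis
      by (rule rpart_ipart_eqI)
        (simp_all add: m' parts m sa_linearD[OF D(1)] sa_mult mult p)
  qed
  moreover have "inj_on (cext \<Phi>) C" using cext_inv(1)[OF \<Phi>] by (rule inj_on_inverseI)
  moreover have "cext \<Phi> (adj x) = adj (cext \<Phi> x)" for x
    by (rule rpart_ipart_eqI)
      (simp_all add: rpart_adj ipart_adj parts sa_linearD[OF D(1)])
  moreover have "cext \<Phi> 1 = 1" by (simp add: cext_sa D(1,7))
  ultimately show ?thesis
    by (simp add: unital_star_isomorphism_def bij_betw_def cext_add cext_scaleC D(1))
qed

text \<open>Every component is a restriction of the same injective map, so naturality is immediate
  and inclusions are preserved and reflected.\<close>

lemma cext_diagram_isomorphism: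
  assumes \<Phi>: "sa_jordan_isomorphism \<Phi>"
  shows "diagram_isomorphism (image (cext \<Phi>)) (\<lambda>_. cext \<Phi>)"
proof -
  note inv = cext_inv[OF \<Phi>] and \<Phi>' = sa_jordan_isomorphismD(6)[OF \<Phi>]
  have "bij_betw (image (cext \<Phi>)) comm_subalgebras comm_subalgebras"
    by (rule bij_betw_byWitness[where f' = "image (cext (inv_into sa \<Phi>))"])
      (auto simp: image_image inv intro: cext_image_comm_subalgebra[OF \<Phi>] cext_image_comm_subalgebra[OF \<Phi>'])
  moreover have "inj (cext \<Phi>)" using inv(1) by (rule inj_on_inverseI)
  ultimately show ?thesis
    using cext_star_isomorphism[OF \<Phi>]
    by (simp add: diagram_isomorphism_def inj_image_subset_iff)
qed

section \<open>States\<close>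

lemma cstar_le_sa: "cstar_le 0 a \<Longrightarrow> adj a = a"
  by (auto simp: cstar_le_def adj_mult adj_adj)

lemma cstar_le_square: "adj s = s \<Longrightarrow> cstar_le 0 (s * s)"
  unfolding cstar_le_def by (rule exI[of _ s]) simp

text \<open>A polarization identity. For self-adjoint \<open>a\<close> both squares are positive, so
  positive functionals are real on \<open>sa\<close>.\<close>

lemma eq_diff_squares:
  fixes a :: "'a::cstar_algebra"
  shows "a = (1/4) *\<^sub>R ((a + 1) * (a + 1)) - (1/4) *\<^sub>R ((a - 1) * (a - 1))"
proof -
  have "(a + 1) * (a + 1) - (a - 1) * (a - 1) = (a + a) + (a + a)"
    by (simp add: algebra_simps)
  also have "\<dots> = 4 *\<^sub>R a" by (simp flip: scaleR_2)
  finally show ?thesis by (simp flip: scaleR_diff_right)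
qed

text \<open>For \<open>M > norm a\<close> the element \<open>M - a\<close> is a square.\<close>

lemma positive_functional_le:
  fixes f :: "'a::cstar_algebra \<Rightarrow> real"
  assumes f: "sa_linear f" and pos: "\<And>a. cstar_le 0 a \<Longrightarrow> 0 \<le> f a" and a: "adj a = a"
  shows "f a \<le> f 1 * norm a"
proof -
  have le: "f a \<le> M * f 1" if "norm a < M" for M
  proof -
    obtain s where s: "adj s = s" "s * s = M *\<^sub>R 1 - a" using sqrt_diff[OF a \<open>norm a < M\<close>] by blast
    have "0 \<le> f (M *\<^sub>R 1 - a)" using pos cstar_le_square[OF s(1)] s(2) by metis
    then show ?thesis using a by (simp add: sa_linearD[OF f] adj_scaleR)
  qed
  have "0 \<le> f 1" using pos cstar_le_square[of "1::'a"] by simp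
  \<comment> \<open>The limit of \<open>M\<close> towards \<open>norm a\<close> is taken after
    division by \<open>f 1\<close>; if \<open>f 1 = 0\<close>, a single \<open>M\<close> already
    gives \<open>f a \<le> 0\<close>.\<close>
  show ?thesis
  proof (cases "f 1 = 0")
    case True
    then show ?thesis using le[of "norm a + 1"] by simp
  next
    case False
    then have "f 1 > 0" using \<open>0 \<le> f 1\<close> by simp
    then have "f a / f 1 \<le> M" if "norm a < M" for M
      using le[OF that] by (simp add: pos_divide_le_eq)
    then have "f a / f 1 \<le> norm a" by (rule dense_ge)
    then show ?thesis using \<open>f 1 > 0\<close> by (simp add: pos_divide_le_eq mult.commute)
  qed
qed

lemma positive_functional_abs_le:
  fixes f :: "'a::cstar_algebra \<Rightarrow> real"
  assumes f: "sa_linear f" and pos: "\<And>a. cstar_le 0 a \<Longrightarrow> 0 \<le> f a" and a: "adj a = a"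
  shows "\<bar>f a\<bar> \<le> f 1 * norm a"
  using positive_functional_le[OF f pos a] positive_functional_le[OF f pos, of "- a"] a
  by (simp add: adj_minus sa_linearD[OF f] abs_le_iff)

text \<open>For positive functionals \<open>positive_functional_abs_le\<close> makes boundedness
  automatic, and the supremum is attained at the unit with value \<open>f 1\<close>. The norm
  condition thus becomes \<open>f 1 = 1\<close>.\<close>

lemma sa_states_iff:
  "f \<in> (sa_states :: ('a::cstar_algebra \<Rightarrow> real) set) \<longleftrightarrow>
     f \<in> extensional sa \<and> sa_linear f \<and> (\<forall>a. cstar_le 0 a \<longrightarrow> 0 \<le> f a) \<and> f 1 = 1"
proof -
  have sup: "(SUP a\<in>sa. \<bar>f a\<bar> / norm a) = f 1"
    if f: "sa_linear f" "\<And>a. cstar_le 0 a \<Longrightarrow> 0 \<le> f a"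
  proof (rule cSup_eq_maximum)
    have "0 \<le> f 1" using f(2) cstar_le_square[of "1::'a"] by simp
    then show "f 1 \<in> (\<lambda>a. \<bar>f a\<bar> / norm a) ` sa" by (intro image_eqI[of _ _ 1]) auto
    fix t assume "t \<in> (\<lambda>a. \<bar>f a\<bar> / norm a) ` sa"
    then obtain a where a: "adj a = a" "t = \<bar>f a\<bar> / norm a" by auto
    have "\<bar>f a\<bar> \<le> f 1 * norm a" using f a(1) by (rule positive_functional_abs_le)
    then show "t \<le> f 1"
      using \<open>0 \<le> f 1\<close> by (cases "a = 0") (simp_all add: a(2) divide_le_eq)
  qed
  have bound: "\<exists>K. \<forall>a\<in>sa. \<bar>f a\<bar> \<le> K * norm a"
    if f: "sa_linear f" "\<And>a. cstar_le 0 a \<Longrightarrow> 0 \<le> f a"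
    using positive_functional_abs_le[OF f] by (intro exI[of _ "f 1"] ballI) simp
  have pos: "(\<forall>a\<in>sa. cstar_le 0 a \<longrightarrow> 0 \<le> f a) \<longleftrightarrow> (\<forall>a. cstar_le 0 a \<longrightarrow> 0 \<le> f a)"
    using cstar_le_sa by auto
  have lin: "(\<forall>a\<in>sa. \<forall>b\<in>sa. f (a + b) = f a + f b) \<and> (\<forall>r. \<forall>a\<in>sa. f (r *\<^sub>R a) = r * f a) \<longleftrightarrow>
      sa_linear f"
    by (simp add: sa_linear_def)
  have "f \<in> sa_states \<longleftrightarrow> f \<in> extensional sa \<and> sa_linear f \<and> (\<exists>K. \<forall>a\<in>sa. \<bar>f a\<bar> \<le> K * norm a) \<and>
      (\<forall>a. cstar_le 0 a \<longrightarrow> 0 \<le> f a) \<and> (SUP a\<in>sa. \<bar>f a\<bar> / norm a) = 1"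
    unfolding sa_states_def mem_Collect_eq lin[symmetric] pos[symmetric] conj_assoc ..
  then show ?thesis using sup bound by auto
qed

lemma sa_linear_Re:
  assumes "\<And>x y. f (x + y) = f x + f y" "\<And>c x. f (c *\<^sub>C x) = c * f x"
  shows "sa_linear (\<lambda>a. Re (f a))"
  by (simp add: sa_linear_def assms scaleR_eq_scaleC)

lemma complex_homogeneous_scaleR:
  fixes f :: "'a::cstar_algebra \<Rightarrow> complex"
  assumes "\<And>c x. f (c *\<^sub>C x) = c * f x"
  shows "f (r *\<^sub>R x) = r *\<^sub>R f x"
  using assms[of "complex_of_real r" x] by (simp add: scaleR_conv_of_real[of r "f x"] flip: scaleR_eq_scaleC)

lemma positive_functional_sa_real:
  fixes f :: "'a::cstar_algebra \<Rightarrow> complex"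
  assumes f: "\<And>x y. f (x + y) = f x + f y" "\<And>c x. f (c *\<^sub>C x) = c * f x"
    and pos: "\<And>x. cstar_le 0 x \<Longrightarrow> f x \<in> \<real>\<^sub>\<ge>\<^sub>0" and a: "adj a = a"
  shows "Im (f a) = 0"
proof -
  note R = complex_homogeneous_scaleR[of f, OF f(2)]
  have diff: "f (x - y) = f x - f y" for x y
    using f(1)[of x "- 1 *\<^sub>R y"] R[of "- 1" y] by simp
  have "Im (f ((a + 1) * (a + 1))) = 0" "Im (f ((a - 1) * (a - 1))) = 0"
    using pos[OF cstar_le_square, of "a + 1"] pos[OF cstar_le_square, of "a - 1"] a
    by (auto simp: adj_add adj_diff complex_nonneg_Reals_iff)
  then show ?thesis
    by (subst eq_diff_squares) (simp add: diff R)
qed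

text \<open>After a rotation \<open>f x\<close> is real, hence the value of \<open>f\<close> at the real part of \<open>x\<close>.\<close>

lemma positive_functional_cmod_le:
  fixes f :: "'a::cstar_algebra \<Rightarrow> complex"
  assumes f: "\<And>x y. f (x + y) = f x + f y" "\<And>c x. f (c *\<^sub>C x) = c * f x"
    and pos: "\<And>x. cstar_le 0 x \<Longrightarrow> f x \<in> \<real>\<^sub>\<ge>\<^sub>0"
  shows "cmod (f x) \<le> Re (f 1) * norm x"
proof -
  have posR: "0 \<le> Re (f a)" if "cstar_le 0 a" for a
    using pos[OF that] by (simp add: complex_nonneg_Reals_iff)
  \<comment> \<open>If \<open>f x = 0\<close> then \<open>c = 0\<close>, so the later estimate
    relies on \<open>cmod c \<le> 1\<close> rather than equality.\<close>
  define c where "c = cnj (sgn (f x))"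
  have "complex_of_real (cmod (f x)) = c * f x"
  proof (cases "f x = 0")
    case False
    have "f x * cnj (f x) = complex_of_real (cmod (f x)) * complex_of_real (cmod (f x))"
      using complex_norm_square[of "f x"] by (simp add: power2_eq_square)
    with False show ?thesis by (simp add: c_def sgn_eq field_simps)
  qed (simp add: c_def)
  also have "\<dots> = f (rpart (c *\<^sub>C x) + \<i> *\<^sub>C ipart (c *\<^sub>C x))" by (simp only: rpart_ipart f(2))
  also have "\<dots> = f (rpart (c *\<^sub>C x)) + \<i> * f (ipart (c *\<^sub>C x))" by (simp only: f)
  finally have "cmod (f x) = Re (f (rpart (c *\<^sub>C x)) + \<i> * f (ipart (c *\<^sub>C x)))"
    by (metis Re_complex_of_real)
  then have "cmod (f x) = Re (f (rpart (c *\<^sub>C x)))"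
    using positive_functional_sa_real[OF f pos, of "ipart (c *\<^sub>C x)"] by simp
  also have "\<dots> \<le> Re (f 1) * norm (rpart (c *\<^sub>C x))"
    using positive_functional_le[OF sa_linear_Re[OF f] posR] by simp
  also have "\<dots> \<le> Re (f 1) * norm x"
  proof (rule mult_left_mono)
    have "cmod c \<le> 1" by (simp add: c_def norm_sgn)
    then have "norm (c *\<^sub>C x) \<le> norm x" by (simp add: norm_scaleC mult_left_le_one_le)
    then show "norm (rpart (c *\<^sub>C x)) \<le> norm x" using norm_rpart order_trans by blast
    show "0 \<le> Re (f 1)" using posR cstar_le_square[of "1::'a"] by simp
  qed
  finally show ?thesis .
qed

text \<open>The estimate \<open>positive_functional_cmod_le\<close> gives boundedness and
  \<open>onorm f \<le> Re (f 1)\<close>; evaluation at the unit gives the converse. As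
  \<open>f 1\<close> is real, norm one means \<open>f 1 = 1\<close>.\<close>

lemma states_iff:
  "f \<in> (states :: ('a::cstar_algebra \<Rightarrow> complex) set) \<longleftrightarrow>
     (\<forall>x y. f (x + y) = f x + f y) \<and> (\<forall>c x. f (c *\<^sub>C x) = c * f x) \<and>
     (\<forall>x. cstar_le 0 x \<longrightarrow> f x \<in> \<real>\<^sub>\<ge>\<^sub>0) \<and> f 1 = 1"
proof -
  have *: "bounded_linear f" "complex_of_real (onorm f) = f 1"
    if f: "\<And>x y. f (x + y) = f x + f y" "\<And>c x. f (c *\<^sub>C x) = c * f x"
      and pos: "\<And>x. cstar_le 0 x \<Longrightarrow> f x \<in> \<real>\<^sub>\<ge>\<^sub>0"
  proof -
    note le = positive_functional_cmod_le[OF f pos]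
    show bl: "bounded_linear f"
      using f le complex_homogeneous_scaleR[of f, OF f(2)] by (intro bounded_linear_intro[where K = "Re (f 1)"]) (auto simp: mult.commute)
    have "f 1 \<in> \<real>\<^sub>\<ge>\<^sub>0" using pos cstar_le_square[of "1::'a"] by simp
    then have f1: "0 \<le> Re (f 1)" "Im (f 1) = 0" by (auto simp: complex_nonneg_Reals_iff)
    have "onorm f \<le> Re (f 1)" using le f1 by (intro onorm_bound) auto
    moreover have "cmod (f 1) \<le> onorm f" using onorm[OF bl, of 1] by simp
    then have "Re (f 1) \<le> onorm f" using complex_Re_le_cmod order_trans by blast
    ultimately show "complex_of_real (onorm f) = f 1" using f1 by (simp add: complex_eq_iff)
  qed
  show ?thesis
  proof
    assume "f \<in> states"
    then have f: "bounded_linear f" "\<And>c x. f (c *\<^sub>C x) = c * f x" "\<And>x. cstar_le 0 x \<Longrightarrow> f x \<in> \<real>\<^sub>\<ge>\<^sub>0"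
      "onorm f = 1" by (auto simp: states_def)
    have add: "f (x + y) = f x + f y" for x y
      using f(1) by (simp add: bounded_linear.linear linear_add)
    show "(\<forall>x y. f (x + y) = f x + f y) \<and> (\<forall>c x. f (c *\<^sub>C x) = c * f x) \<and>
      (\<forall>x. cstar_le 0 x \<longrightarrow> f x \<in> \<real>\<^sub>\<ge>\<^sub>0) \<and> f 1 = 1"
      using add f *(2)[OF add f(2,3)] by simp
  next
    assume f: "(\<forall>x y. f (x + y) = f x + f y) \<and> (\<forall>c x. f (c *\<^sub>C x) = c * f x) \<and>
      (\<forall>x. cstar_le 0 x \<longrightarrow> f x \<in> \<real>\<^sub>\<ge>\<^sub>0) \<and> f 1 = 1"
    then have "bounded_linear f" "complex_of_real (onorm f) = f 1" using * by blast+
    then show "f \<in> states" using f by (simp add: states_def)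
  qed
qed

lemma statesD:
  assumes "f \<in> states"
  shows "f (x + y) = f x + f y" "f (c *\<^sub>C x) = c * f x" "cstar_le 0 x \<Longrightarrow> f x \<in> \<real>\<^sub>\<ge>\<^sub>0" "f 1 = 1"
    "f (r *\<^sub>R x) = r *\<^sub>R f x" "adj a = a \<Longrightarrow> Im (f a) = 0" "cmod (f x) \<le> norm x" "sa_linear f"
proof -
  note f = assms[unfolded states_iff]
  show add: "f (x + y) = f x + f y" and C: "f (c *\<^sub>C x) = c * f x"
    and pos: "cstar_le 0 x \<Longrightarrow> f x \<in> \<real>\<^sub>\<ge>\<^sub>0" and "f 1 = 1" for x y c
    using f by blast+
  show R: "f (r *\<^sub>R x) = r *\<^sub>R f x" for r x
    by (rule complex_homogeneous_scaleR[of f, OF C])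
  show "adj a = a \<Longrightarrow> Im (f a) = 0" using positive_functional_sa_real[OF add C pos] by blast
  show "cmod (f x) \<le> norm x" using positive_functional_cmod_le[OF add C pos, of x] \<open>f 1 = 1\<close> by simp
  show "sa_linear f" by (simp add: sa_linear_def add R)
qed

text \<open>By \<open>states_iff\<close> only algebraic conditions remain, and positive elements are
  self-adjoint, where the extension is \<open>\<phi>\<close> itself.\<close>

lemma cext_state:
  fixes \<phi> :: "'a::cstar_algebra \<Rightarrow> complex"
  assumes \<phi>: "sa_linear \<phi>" and pos: "\<And>a. cstar_le 0 a \<Longrightarrow> \<phi> a \<in> \<real>\<^sub>\<ge>\<^sub>0" and "\<phi> 1 = 1"
  shows "cext \<phi> \<in> states"
  using pos \<open>\<phi> 1 = 1\<close> unfolding states_iff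
  by (simp add: cext_add[OF \<phi>] cext_scaleC[OF \<phi>] scaleC_complex_def cext_sa[OF \<phi>] cstar_le_sa)

lemma cext_of_state: "f \<in> states \<Longrightarrow> cext f = f"
  by (rule ext) (simp add: cext_eq statesD(1,2) scaleC_complex_def)

lemma restrict_to_sa_state:
  assumes f: "f \<in> states"
  shows "restrict_to_sa f \<in> sa_states"
proof -
  note D = statesD[OF f]
  have "0 \<le> Re (f a)" if "cstar_le 0 a" for a
    using D(3)[OF that] by (simp add: complex_nonneg_Reals_iff)
  then show ?thesis
    by (simp add: sa_states_iff restrict_to_sa_def sa_linear_def adj_add adj_scaleR D cstar_le_sa)
qed

lemma cext_sa_state:
  assumes g: "g \<in> sa_states"
  shows "cext (\<lambda>a. complex_of_real (g a)) \<in> states"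
  using g[unfolded sa_states_iff] by (intro cext_state) (auto simp: sa_linear_def scaleR_conv_of_real)

lemma restrict_to_sa_cext:
  assumes g: "g \<in> sa_states"
  shows "restrict_to_sa (cext (\<lambda>a. complex_of_real (g a))) = g"
proof
  have lin: "sa_linear (\<lambda>a. complex_of_real (g a))"
    using g[unfolded sa_states_iff] by (auto simp: sa_linear_def scaleR_conv_of_real)
  have ext: "g \<in> extensional sa" using g by (simp add: sa_states_iff)
  show "restrict_to_sa (cext (\<lambda>a. complex_of_real (g a))) a = g a" for a
    using extensional_arb[OF ext, of a] by (simp add: restrict_to_sa_def restrict_def cext_sa[OF lin])
qed

text \<open>States are real on \<open>sa\<close>, so taking real parts loses nothing there, and
  complex linearity recovers the rest.\<close>

lemma cext_restrict_to_sa: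
  assumes f: "f \<in> states"
  shows "cext (\<lambda>a. complex_of_real (restrict_to_sa f a)) = f"
proof
  fix x
  have "cext (\<lambda>a. complex_of_real (restrict_to_sa f a)) x = cext f x"
    by (rule cext_cong) (simp add: restrict_to_sa_def complex_eq_iff statesD(6)[OF f])
  then show "cext (\<lambda>a. complex_of_real (restrict_to_sa f a)) x = f x"
    by (simp add: cext_of_state[OF f])
qed

section \<open>Weak* topology and affine homeomorphisms\<close>

lemma continuous_map_weak_star_eval:
  assumes "x \<in> X"
  shows "continuous_map (weak_star X S) euclidean (\<lambda>f. f x)"
  unfolding weak_star_def using assms
  by (intro continuous_map_from_subtopology continuous_map_product_projection)

text \<open>The points of a product topology over \<open>X\<close> are extensional on
  \<open>X\<close>; for \<open>X = UNIV\<close> the hypothesis holds trivially.\<close>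

lemma topspace_weak_star: "S \<subseteq> extensional X \<Longrightarrow> topspace (weak_star X S) = S"
  by (auto simp: weak_star_def PiE_def)

lemma continuous_map_into_weak_star:
  assumes "S \<subseteq> extensional X" "T \<subseteq> extensional Y" "\<And>f. f \<in> S \<Longrightarrow> h f \<in> T"
    and "\<And>y. y \<in> Y \<Longrightarrow> continuous_map (weak_star X S) euclidean (\<lambda>f. h f y)"
  shows "continuous_map (weak_star X S) (weak_star Y T) h"
  unfolding weak_star_def[of Y T] continuous_map_in_subtopology continuous_map_componentwise
  using assms by (auto simp: topspace_weak_star)

lemma affine_homeomorphismI:
  assumes ext: "S \<subseteq> extensional X" "T \<subseteq> extensional Y"
    and h: "\<And>f. f \<in> S \<Longrightarrow> h f \<in> T" "\<And>f. f \<in> S \<Longrightarrow> g (h f) = f"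
      "\<And>y. y \<in> Y \<Longrightarrow> continuous_map (weak_star X S) euclidean (\<lambda>f. h f y)"
    and g: "\<And>f. f \<in> T \<Longrightarrow> g f \<in> S" "\<And>f. f \<in> T \<Longrightarrow> h (g f) = f"
      "\<And>x. x \<in> X \<Longrightarrow> continuous_map (weak_star Y T) euclidean (\<lambda>f. g f x)"
    and aff: "\<And>f f' k t y. f \<in> S \<Longrightarrow> f' \<in> S \<Longrightarrow> k \<in> S \<Longrightarrow>
      (\<And>x. x \<in> X \<Longrightarrow> k x = (1 - t) *\<^sub>R f x + t *\<^sub>R f' x) \<Longrightarrow> y \<in> Y \<Longrightarrow>
      h k y = (1 - t) *\<^sub>R h f y + t *\<^sub>R h f' y"
  shows "affine_homeomorphism X S Y T h"
proof -
  have "homeomorphic_maps (weak_star X S) (weak_star Y T) h g"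
    using assms by (simp add: homeomorphic_maps_def topspace_weak_star continuous_map_into_weak_star)
  then show ?thesis
    using aff unfolding affine_homeomorphism_def homeomorphic_map_maps by blast
qed

text \<open>A value of the extension combines two values at self-adjoint elements, so pointwise
  convergence on \<open>sa\<close> controls it on the whole algebra.\<close>

lemma continuous_map_cext_eval:
  fixes h :: "'c \<Rightarrow> 'a::cstar_algebra \<Rightarrow> complex"
  assumes "\<And>a. adj a = a \<Longrightarrow> continuous_map X euclidean (\<lambda>f. h f a)"
  shows "continuous_map X euclidean (\<lambda>f. cext (h f) x)"
proof -
  have "continuous_map euclidean euclidean (\<lambda>z. \<i> * z)"
    by (simp add: continuous_map_iff_continuous2 continuous_intros)
  from continuous_map_compose[OF assms[OF adj_ipart[of x]] this]
  have "continuous_map X euclidean (\<lambda>f. \<i> * h f (ipart x))" by (simp add: o_def)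
  with assms[OF adj_rpart[of x]]
  have "continuous_map X euclidean (\<lambda>f. h f (rpart x) + \<i> * h f (ipart x))"
    by (rule continuous_map_add)
  then show ?thesis by (simp add: cext_def scaleC_complex_def)
qed

lemma restrict_to_sa_affine_homeomorphism:
  "affine_homeomorphism UNIV (states :: ('a::cstar_algebra \<Rightarrow> complex) set) sa sa_states restrict_to_sa"
proof (rule affine_homeomorphismI[where g = "\<lambda>g. cext (\<lambda>a. complex_of_real (g a))"])
  show "sa_states \<subseteq> extensional sa" by (auto simp: sa_states_iff)
  fix a :: 'a assume a: "a \<in> sa"
  have "continuous_map (weak_star UNIV states) euclidean (Re \<circ> (\<lambda>f :: 'a \<Rightarrow> complex. f a))"
    by (rule continuous_map_compose[OF continuous_map_weak_star_eval]) (auto intro!: continuous_intros)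
  then show "continuous_map (weak_star UNIV states) euclidean (\<lambda>f. restrict_to_sa f a)"
    using a by (simp add: restrict_to_sa_def o_def)
next
  fix x :: 'a
  have "continuous_map (weak_star sa sa_states) euclidean (complex_of_real \<circ> (\<lambda>g :: 'a \<Rightarrow> real. g a))"
    if "adj a = a" for a
    using that
    by (intro continuous_map_compose[OF continuous_map_weak_star_eval]) (auto intro!: continuous_intros)
  then show "continuous_map (weak_star sa sa_states) euclidean
      (\<lambda>g. cext (\<lambda>a. complex_of_real (g a)) x)"
    by (intro continuous_map_cext_eval) (simp add: o_def)
next
  fix f f' k :: "'a \<Rightarrow> complex" and t and a :: 'a
  assume "\<And>x. x \<in> UNIV \<Longrightarrow> k x = (1 - t) *\<^sub>R f x + t *\<^sub>R f' x" "a \<in> sa"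
  then show "restrict_to_sa k a = (1 - t) *\<^sub>R restrict_to_sa f a + t *\<^sub>R restrict_to_sa f' a"
    by (simp add: restrict_to_sa_def)
qed (auto simp: restrict_to_sa_state cext_sa_state restrict_to_sa_cext cext_restrict_to_sa)

section \<open>Order isomorphisms and pullback of states\<close>

lemma sa_order_isomorphismD:
  fixes \<Phi> :: "'a::cstar_algebra \<Rightarrow> 'b::cstar_algebra"
  assumes "sa_order_isomorphism \<Phi>"
  shows "sa_linear \<Phi>" "adj a = a \<Longrightarrow> adj (\<Phi> a) = \<Phi> a" "adj a = a \<Longrightarrow> norm (\<Phi> a) = norm a"
    "cstar_le 0 a \<Longrightarrow> cstar_le 0 (\<Phi> a)"
    "adj a = a \<Longrightarrow> inv_into sa \<Phi> (\<Phi> a) = a" "adj b = b \<Longrightarrow> \<Phi> (inv_into sa \<Phi> b) = b"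
    "sa_order_isomorphism (inv_into sa \<Phi>)"
proof -
  have lin: "linear_isomorphism sa sa \<Phi>" and norm: "\<And>a. adj a = a \<Longrightarrow> norm (\<Phi> a) = norm a"
    and le: "\<And>a b. adj a = a \<Longrightarrow> adj b = b \<Longrightarrow> cstar_le a b \<longleftrightarrow> cstar_le (\<Phi> a) (\<Phi> b)"
    using assms by (auto simp: sa_order_isomorphism_def)
  have bij: "bij_betw \<Phi> sa sa" using lin by (simp add: linear_isomorphism_def)
  show sl: "sa_linear \<Phi>" using lin by (simp add: linear_isomorphism_def sa_linear_def)
  show "adj (\<Phi> a) = \<Phi> a" if "adj a = a"
    using bij_betwE[OF bij] that by simp
  show "norm (\<Phi> a) = norm a" if "adj a = a" using norm[OF that] .
  show "cstar_le 0 (\<Phi> a)" if "cstar_le 0 a"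
    using le[of 0 a] that by (simp add: cstar_le_sa sa_linearD[OF sl])
  let ?g = "inv_into sa \<Phi>"
  show "?g (\<Phi> a) = a" if "adj a = a"
    using bij that by (simp add: bij_betw_inv_into_left)
  show inv: "\<Phi> (?g b) = b" if "adj b = b" for b
    using bij that by (simp add: bij_betw_inv_into_right)
  have sa: "adj (?g b) = ?g b" if "adj b = b" for b
    using bij_betwE[OF bij_betw_inv_into[OF bij]] that by simp
  show "sa_order_isomorphism ?g"
    using linear_isomorphism_inv[OF lin subspace_sa] norm[OF sa] le[OF sa sa]
    by (simp add: sa_order_isomorphism_def inv)
qed

lemma pullback_state_one_le:
  assumes \<Phi>: "sa_order_isomorphism \<Phi>" and \<rho>: "\<rho> \<in> states"
  shows "Re (\<rho> (\<Phi> 1)) \<le> 1"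
proof -
  have "Re (\<rho> (\<Phi> 1)) \<le> norm (\<Phi> 1)"
    using complex_Re_le_cmod statesD(7)[OF \<rho>] order_trans by blast
  then show ?thesis by (simp add: sa_order_isomorphismD(3)[OF \<Phi>])
qed

text \<open>An order isomorphism is not assumed unital. With \<open>u = inv \<Phi> 1\<close>, of norm 1, positivity gives
  \<open>1 = \<rho> (\<Phi> u) \<le> \<rho> (\<Phi> 1) \<le> norm (\<Phi> 1) = 1\<close>.\<close>

lemma sa_order_isomorphism_pullback_state:
  assumes \<Phi>: "sa_order_isomorphism \<Phi>" and \<rho>: "\<rho> \<in> states"
  shows "cext (\<lambda>a. \<rho> (\<Phi> a)) \<in> states"
proof (rule cext_state)
  note D = sa_order_isomorphismD[OF \<Phi>] and R = statesD[OF \<rho>]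
  show lin: "sa_linear (\<lambda>a. \<rho> (\<Phi> a))"
    by (simp add: sa_linear_def sa_linearD[OF D(1)] R)
  show pos: "\<rho> (\<Phi> a) \<in> \<real>\<^sub>\<ge>\<^sub>0" if "cstar_le 0 a" for a using that by (intro R(3) D(4))
  let ?u = "inv_into sa \<Phi> 1"
  have u: "adj ?u = ?u" using sa_order_isomorphismD(2)[OF D(7)] by simp
  have "norm ?u = 1" using sa_order_isomorphismD(3)[OF D(7), of 1] by simp
  moreover have "Re (\<rho> (\<Phi> ?u)) = 1" by (simp add: D(6) R(4))
  moreover have "sa_linear (\<lambda>a. Re (\<rho> (\<Phi> a)))" using lin by (simp add: sa_linear_def)
  moreover have "0 \<le> Re (\<rho> (\<Phi> a))" if "cstar_le 0 a" for a
    using pos[OF that] by (simp add: complex_nonneg_Reals_iff)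
  ultimately have "1 \<le> Re (\<rho> (\<Phi> 1))"
    using positive_functional_le[of "\<lambda>a. Re (\<rho> (\<Phi> a))" ?u] u by simp
  with pullback_state_one_le[OF assms] have "Re (\<rho> (\<Phi> 1)) = 1" by simp
  then show "\<rho> (\<Phi> 1) = 1" by (simp add: complex_eq_iff R(6) D(2))
qed

text \<open>On \<open>sa\<close> the double pullback is
  \<open>\<rho> (\<Phi> (\<Psi> b)) = \<rho> b\<close>, and a state is the extension of its values
  there. Keeping \<open>\<Phi>\<close> and \<open>\<Psi>\<close> general lets one lemma give both
  inverse laws.\<close>

lemma pullback_state_inverse:
  assumes \<rho>: "\<rho> \<in> states" and lin: "sa_linear (\<lambda>a. \<rho> (\<Phi> a))"
    and \<Psi>: "\<And>b. adj b = b \<Longrightarrow> adj (\<Psi> b) = \<Psi> b" "\<And>b. adj b = b \<Longrightarrow> \<Phi> (\<Psi> b) = b"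
  shows "cext (\<lambda>b. cext (\<lambda>a. \<rho> (\<Phi> a)) (\<Psi> b)) = \<rho>"
proof
  fix x
  have "cext (\<lambda>b. cext (\<lambda>a. \<rho> (\<Phi> a)) (\<Psi> b)) x = cext \<rho> x"
    by (rule cext_cong) (simp add: cext_sa[OF lin] \<Psi>)
  then show "cext (\<lambda>b. cext (\<lambda>a. \<rho> (\<Phi> a)) (\<Psi> b)) x = \<rho> x" by (simp add: cext_of_state[OF \<rho>])
qed

lemma sa_order_isomorphism_states:
  fixes \<Phi> :: "'a::cstar_algebra \<Rightarrow> 'b::cstar_algebra"
  assumes \<Phi>: "sa_order_isomorphism \<Phi>"
  shows "affine_homeomorphism UNIV (states :: ('b \<Rightarrow> complex) set) UNIV (states :: ('a \<Rightarrow> complex) set)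
    (\<lambda>\<rho>. cext (\<lambda>a. \<rho> (\<Phi> a)))"
proof (rule affine_homeomorphismI[where g = "\<lambda>\<rho>. cext (\<lambda>b. \<rho> (inv_into sa \<Phi> b))"])
  note D = sa_order_isomorphismD[OF \<Phi>]
  note D' = sa_order_isomorphismD[OF D(7)]
  show "cext (\<lambda>a. \<rho> (\<Phi> a)) \<in> states" if "\<rho> \<in> states" for \<rho>
    using sa_order_isomorphism_pullback_state[OF \<Phi> that] .
  show "cext (\<lambda>b. \<rho> (inv_into sa \<Phi> b)) \<in> states" if "\<rho> \<in> states" for \<rho>
    using sa_order_isomorphism_pullback_state[OF D(7) that] .
  show "cext (\<lambda>b. cext (\<lambda>a. \<rho> (\<Phi> a)) (inv_into sa \<Phi> b)) = \<rho>" if "\<rho> \<in> states" for \<rho>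
    using that by (rule pullback_state_inverse)
      (simp_all add: sa_linear_def sa_linearD[OF D(1)] statesD[OF that] D'(2) D(6))
  show "cext (\<lambda>a. cext (\<lambda>b. \<rho> (inv_into sa \<Phi> b)) (\<Phi> a)) = \<rho>" if "\<rho> \<in> states" for \<rho>
    using that by (rule pullback_state_inverse)
      (simp_all add: sa_linear_def sa_linearD[OF D'(1)] statesD[OF that] D(2) D(5))
  fix f f' k :: "'b \<Rightarrow> complex" and t and y :: 'a
  assume "\<And>x. x \<in> UNIV \<Longrightarrow> k x = (1 - t) *\<^sub>R f x + t *\<^sub>R f' x"
  then have k: "k = (\<lambda>x. (1 - t) *\<^sub>R f x + t *\<^sub>R f' x)" by auto
  show "cext (\<lambda>a. k (\<Phi> a)) y = (1 - t) *\<^sub>R cext (\<lambda>a. f (\<Phi> a)) y + t *\<^sub>R cext (\<lambda>a. f' (\<Phi> a)) y"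
    by (simp add: k cext_def scaleC_complex_def scaleR_conv_of_real distrib_left mult.left_commute)
qed (auto intro!: continuous_map_cext_eval continuous_map_weak_star_eval)

text \<open>"Determined by" is rendered twice: as an explicit reconstruction from the self-adjoint
  part, and as the transport of every isomorphism of self-adjoint parts. The prescribed values on
  self-adjoint elements fix \<open>T\<close> and each \<open>\<eta> C\<close> by complex linearity.
  States are transported along isomorphisms of ordered Banach spaces, the diagram along Jordan
  isomorphisms.\<close>

theorem lemma3p4:
  shows
    "(unital_jb_algebra (sa :: 'a::cstar_algebra set) (\<circ>\<^sub>J) 1 \<and>
      (\<forall>C \<in> (comm_subalgebras :: 'a set set).
         banach_unital_assoc_subalgebra sa (\<circ>\<^sub>J) 1 (sa_part C))) \<and>
     (sa :: 'a set) = (\<Union>C \<in> comm_subalgebras. sa_part C) \<and>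
     (affine_homeomorphism UNIV (states :: ('a \<Rightarrow> complex) set) sa sa_states restrict_to_sa \<and>
      (\<forall>\<Phi> :: 'a \<Rightarrow> 'b::cstar_algebra. sa_order_isomorphism \<Phi> \<longrightarrow>
         (\<exists>T. affine_homeomorphism UNIV (states :: ('b \<Rightarrow> complex) set) UNIV states T \<and>
              (\<forall>\<rho>\<in>states. \<forall>a\<in>sa. T \<rho> a = \<rho> (\<Phi> a))))) \<and>
     (bij_betw sa_part (comm_subalgebras :: 'a set set)
        {J. banach_unital_assoc_subalgebra sa (\<circ>\<^sub>J) 1 J} \<and>
      (\<forall>C \<in> (comm_subalgebras :: 'a set set). \<forall>D \<in> comm_subalgebras.
         C \<subseteq> D \<longleftrightarrow> sa_part C \<subseteq> sa_part D) \<and>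
      (\<forall>C \<in> (comm_subalgebras :: 'a set set).
         C = {a + \<i> *\<^sub>C b | a b. a \<in> sa_part C \<and> b \<in> sa_part C}) \<and>
      (\<forall>\<Phi> :: 'a \<Rightarrow> 'b::cstar_algebra. sa_jordan_isomorphism \<Phi> \<longrightarrow>
         (\<exists>F \<eta>. diagram_isomorphism F \<eta> \<and>
                (\<forall>C\<in>comm_subalgebras. \<forall>a\<in>sa_part C. \<eta> C a = \<Phi> a))))"
proof (intro conjI)
  show "unital_jb_algebra (sa :: 'a set) (\<circ>\<^sub>J) 1" by (rule unital_jb_algebra_sa)
  show "\<forall>C \<in> (comm_subalgebras :: 'a set set). banach_unital_assoc_subalgebra sa (\<circ>\<^sub>J) 1 (sa_part C)"
    by (simp add: assoc_subalgebra_sa_part)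
  have "\<exists>C\<in>comm_subalgebras. a \<in> sa_part C" if "adj a = a" for a :: 'a
    using that by (rule sa_in_comm_subalgebra) blast
  then show "(sa :: 'a set) = (\<Union>C \<in> comm_subalgebras. sa_part C)"
    by (auto simp: sa_part_def)
  show "affine_homeomorphism UNIV (states :: ('a \<Rightarrow> complex) set) sa sa_states restrict_to_sa"
    by (rule restrict_to_sa_affine_homeomorphism)
  show "\<forall>\<Phi> :: 'a \<Rightarrow> 'b. sa_order_isomorphism \<Phi> \<longrightarrow>
         (\<exists>T. affine_homeomorphism UNIV (states :: ('b \<Rightarrow> complex) set) UNIV states T \<and>
              (\<forall>\<rho>\<in>states. \<forall>a\<in>sa. T \<rho> a = \<rho> (\<Phi> a)))"
  proof (intro allI impI exI conjI ballI)
    fix \<Phi> :: "'a \<Rightarrow> 'b" and \<rho> :: "'b \<Rightarrow> complex" and a :: 'a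
    assume \<Phi>: "sa_order_isomorphism \<Phi>"
    then show "affine_homeomorphism UNIV (states :: ('b \<Rightarrow> complex) set) UNIV (states :: ('a \<Rightarrow> complex) set)
        (\<lambda>\<rho>. cext (\<lambda>a. \<rho> (\<Phi> a)))"
      by (rule sa_order_isomorphism_states)
    assume "\<rho> \<in> states" "a \<in> sa"
    then show "cext (\<lambda>a. \<rho> (\<Phi> a)) a = \<rho> (\<Phi> a)"
      by (intro cext_sa) (simp_all add: sa_linear_def sa_linearD[OF sa_order_isomorphismD(1)[OF \<Phi>]] statesD)
  qed
  show "bij_betw sa_part (comm_subalgebras :: 'a set set)
        {J. banach_unital_assoc_subalgebra sa (\<circ>\<^sub>J) 1 J}"
    by (rule bij_betw_sa_part)
  show "\<forall>C \<in> (comm_subalgebras :: 'a set set). \<forall>D \<in> comm_subalgebras.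
         C \<subseteq> D \<longleftrightarrow> sa_part C \<subseteq> sa_part D"
    using sa_part_subset_iff by blast
  show "\<forall>C \<in> (comm_subalgebras :: 'a set set).
         C = {a + \<i> *\<^sub>C b | a b. a \<in> sa_part C \<and> b \<in> sa_part C}"
  proof
    fix C :: "'a set" assume C: "C \<in> comm_subalgebras"
    have sub: "sa_part C \<subseteq> sa" by (auto simp: sa_part_def)
    show "C = {a + \<i> *\<^sub>C b | a b. a \<in> sa_part C \<and> b \<in> sa_part C}"
      by (simp only: complexification_eq[OF sub, symmetric] complexification_sa_part[OF C])
  qed
  show "\<forall>\<Phi> :: 'a \<Rightarrow> 'b. sa_jordan_isomorphism \<Phi> \<longrightarrow>
         (\<exists>F \<eta>. diagram_isomorphism F \<eta> \<and>
                (\<forall>C\<in>comm_subalgebras. \<forall>a\<in>sa_part C. \<eta> C a = \<Phi> a))"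
  proof (intro allI impI)
    fix \<Phi> :: "'a \<Rightarrow> 'b" assume \<Phi>: "sa_jordan_isomorphism \<Phi>"
    have "cext \<Phi> a = \<Phi> a" if "a \<in> sa_part C" for a C
      using that by (simp add: sa_part_def cext_sa sa_jordan_isomorphismD(1)[OF \<Phi>])
    then show "\<exists>F \<eta>. diagram_isomorphism F \<eta> \<and>
                (\<forall>C\<in>comm_subalgebras. \<forall>a\<in>sa_part C. \<eta> C a = \<Phi> a)"
      using cext_diagram_isomorphism[OF \<Phi>] by blast
  qed
qed

end
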